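(* Assume that the parameters $(t,\{a_i\},\{b_j\})$ of the ascending Hall--Littlewood process and the parameters $(Q,\{\xi_x\},\{u_y\})$ of the stochastic six vertex model in the quadrant are related by $$t=Q,\qquad a_x=\frac{\sqrt t}{\xi_x}\ \text{ for all }x\ge 1,\qquad b_y=\frac{1}{t\,u_y}\ \text{ for all }y\ge 1 .$$ Then for any positive integers $N,k$ and $m_1,\dots,m_k$, the random vector $(N-\lambda_1'(m_1,N),\dots,N-\lambda_1'(m_k,N))$ has the same distribution as the random vector $(h(m_1+1,N),\dots,h(m_k+1,N))$.
   Context: **Partitions and Hall--Littlewood functions.** A partition $\lambda$ is a finite non-increasing sequence of positive integers; $\lambda_1'$ denotes its number of parts (length of the first column), $|\lambda|$ the sum of its parts, $m_i(\lambda)$ the number of parts equal to $i\ge 1$. Write $\mu\prec\lambda$ (interlacing) if $\lambda_1\ge\mu_1\ge\lambda_2\ge\mu_2\ge\cdots$. Fix $0<t<1$. $P_{\lambda/\mu},Q_{\lambda/\mu}$ are the skew Hall--Littlewood symmetric functions with parameter $t$ (Macdonald's book, Chapter III); $P_\lambda=P_{\lambda/\varnothing}$, $Q_\lambda=Q_{\lambda/\varnothing}$. In one variable: $P_{\lambda/\mu}(a)=a^{|\lambda|-|\mu|}\prod_{i\ge1:\,m_i(\lambda)+1=m_i(\mu)}(1-t^{m_i(\mu)})$ and $Q_{\lambda/\mu}(b)=b^{|\lambda|-|\mu|}\prod_{i\ge1:\,m_i(\lambda)=m_i(\mu)+1}(1-t^{m_i(\lambda)})$ if $\mu\prec\lambda$,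 and both are $0$ otherwise. **Ascending Hall--Littlewood process.** Let $a_i>0$, $b_j>0$ with $a_ib_j<1$ for all $i,j\ge1$. For positive integers $M,N$ it is the probability measure on sequences of partitions $\lambda^{(1)}\subset\dots\subset\lambda^{(M)}$ given by $$\mathrm{Prob}_{M,N}(\lambda^{(1)}\subset\dots\subset\lambda^{(M)})=\frac{P_{\lambda^{(1)}}(a_1)P_{\lambda^{(2)}/\lambda^{(1)}}(a_2)\cdots P_{\lambda^{(M)}/\lambda^{(M-1)}}(a_M)\,Q_{\lambda^{(M)}}(b_1,\dots,b_N)}{\prod_{j=1}^N\prod_{i=1}^M\frac{1-ta_ib_j}{1-a_ib_j}} .$$ These measures are consistent in $M$ for fixed $N$. $\lambda_1'(m,N)$ denotes the length of the first column of the random partition $\lambda^{(m)}$, for $1\le m\le M$ (take any $M\ge\max_i m_i$; all the $\lambda_1'(m_i,N)$ are taken from the same random sequence). **Stochastic six vertex model in the quadrant.** Parameters: $0<Q<1$, $\xi_x>0$, $u_y>0$ with $\xi_xu_y>1/\sqrt Q$ for all $x,y\ge1$. Vertices are the points $(x,y)\in\mathbb Z_{\ge1}^2$; each lattice edge may be occupied by an arrow (pointing right or up) or be empty. The left edge of each vertex $(1,y)$ is occupied, the bottom edge of each vertex $(x,1)$ is empty. Vertices are sampled successively in order of increasing $x+y$: given the occupation of the left and bottom edges of $(x,y)$, the occupations of its right and top edges are chosen (independently of everything else given these incoming edges) as follows: - left and bottom empty: right and top empty; left and bottom occupied: right and top occupied; - left occupied, bottom empty: only the right edge is occupied with probability $\frac{Q^{-1}-Q^{-1/2}\xi_xu_y}{1-Q^{-1/2}\xi_xu_y}$,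 only the top edge with probability $\frac{1-Q^{-1}}{1-Q^{-1/2}\xi_xu_y}$; - left empty, bottom occupied: only the top edge is occupied with probability $\frac{1-Q^{1/2}\xi_xu_y}{1-Q^{-1/2}\xi_xu_y}$, only the right edge with probability $\frac{(Q-1)Q^{-1/2}\xi_xu_y}{1-Q^{-1/2}\xi_xu_y}$. The occupied edges form up-right paths. The height function $h(x,y)$ is the number of up-right paths which go through or to the right of the point $(x,y)$; equivalently, $h(x,y)$ is the number of $y'\in\{1,\dots,y\}$ such that the left edge of the vertex $(x,y')$ is occupied. *)

theory Defs
  imports "HOL-Probability.Probability" "HOL-Library.More_List"
begin

section \<open>Partitions\<close>

text \<open>A partition is the list of its (positive) parts, so that the length of the first column of
  \<open>\<kappa>\<close> is \<open>length \<kappa>\<close>, its size is \<open>sum_list \<kappa>\<close>, and the number of parts equal to \<open>i\<close> is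
  \<open>count_list \<kappa> i\<close>. Where needed, \<open>nth_default 0\<close> pads it with zeros (positions start at 0).\<close>

definition is_partition :: "nat list \<Rightarrow> bool" where
  "is_partition \<kappa> \<longleftrightarrow> sorted_wrt (\<ge>) \<kappa> \<and> (\<forall>x\<in>set \<kappa>. 0 < x)"

definition contained :: "nat list \<Rightarrow> nat list \<Rightarrow> bool" where
  "contained \<mu> \<kappa> \<longleftrightarrow> (\<forall>i. nth_default 0 \<mu> i \<le> nth_default 0 \<kappa> i)"

definition interlaces :: "nat list \<Rightarrow> nat list \<Rightarrow> bool" where
  "interlaces \<mu> \<kappa> \<longleftrightarrow>
     (\<forall>i. nth_default 0 \<mu> i \<le> nth_default 0 \<kappa> i \<and> nth_default 0 \<kappa> (Suc i) \<le> nth_default 0 \<mu> i)"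

lemma interlaces_imp_contained: "interlaces \<mu> \<kappa> \<Longrightarrow> contained \<mu> \<kappa>"
  by (simp add: interlaces_def contained_def)

lemma contained_imp_length_le:
  assumes "contained \<mu> \<kappa>" "is_partition \<mu>"
  shows "length \<mu> \<le> length \<kappa>"
proof (rule ccontr)
  assume "\<not> length \<mu> \<le> length \<kappa>"
  hence l: "length \<kappa> < length \<mu>" by simp
  have "nth_default 0 \<mu> (length \<kappa>) \<le> nth_default 0 \<kappa> (length \<kappa>)"
    using assms(1) by (simp add: contained_def)
  hence "\<mu> ! length \<kappa> = 0" using l by (simp add: nth_default_def)
  moreover have "\<mu> ! length \<kappa> \<in> set \<mu>" using l by simp
  ultimately show False using assms(2) by (auto simp: is_partition_def)
qed

lemma finite_contained: "finite {\<mu>. is_partition \<mu> \<and> contained \<mu> \<kappa>}"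
proof (rule finite_subset)
  show "{\<mu>. is_partition \<mu> \<and> contained \<mu> \<kappa>}
          \<subseteq> {\<mu>. set \<mu> \<subseteq> {..sum_list \<kappa>} \<and> length \<mu> \<le> length \<kappa>}"
  proof safe
    fix \<mu> x assume p: "is_partition \<mu>" and c: "contained \<mu> \<kappa>" and x: "x \<in> set \<mu>"
    from x obtain i where i: "i < length \<mu>" "x = \<mu> ! i" by (auto simp: in_set_conv_nth)
    have il: "i < length \<kappa>" using i contained_imp_length_le[OF c p] by simp
    have "nth_default 0 \<mu> i \<le> nth_default 0 \<kappa> i" using c by (simp add: contained_def)
    hence "x \<le> \<kappa> ! i" using i il by (simp add: nth_default_def)
    also have "\<dots> \<le> sum_list \<kappa>" using il by (rule elem_le_sum_list)
    finally show "x \<le> sum_list \<kappa>" .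
  qed (use contained_imp_length_le in blast)
  show "finite {\<mu>. set \<mu> \<subseteq> {..sum_list \<kappa>} \<and> length \<mu> \<le> length \<kappa>}"
    by (rule finite_lists_length_le) simp
qed

lemma finite_interlaces: "finite {\<mu>. is_partition \<mu> \<and> interlaces \<mu> \<kappa>}"
  by (rule finite_subset[OF _ finite_contained[of \<kappa>]]) (auto intro: interlaces_imp_contained)

section \<open>Skew Hall--Littlewood functions\<close>

text \<open>\<open>hl_P1 t \<kappa> \<mu> a\<close> and \<open>hl_Q1 t \<kappa> \<mu> b\<close> are \<open>P\<^bsub>\<kappa>/\<mu>\<^esub>(a)\<close> and \<open>Q\<^bsub>\<kappa>/\<mu>\<^esub>(b)\<close> in one variable.\<close>

definition hl_P1 :: "real \<Rightarrow> nat list \<Rightarrow> nat list \<Rightarrow> real \<Rightarrow> real" where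
  "hl_P1 t \<kappa> \<mu> a =
     (if interlaces \<mu> \<kappa>
      then a ^ (sum_list \<kappa> - sum_list \<mu>) *
           (\<Prod>i | 1 \<le> i \<and> count_list \<kappa> i + 1 = count_list \<mu> i. 1 - t ^ count_list \<mu> i)
      else 0)"

definition hl_Q1 :: "real \<Rightarrow> nat list \<Rightarrow> nat list \<Rightarrow> real \<Rightarrow> real" where
  "hl_Q1 t \<kappa> \<mu> b =
     (if interlaces \<mu> \<kappa>
      then b ^ (sum_list \<kappa> - sum_list \<mu>) *
           (\<Prod>i | 1 \<le> i \<and> count_list \<kappa> i = count_list \<mu> i + 1. 1 - t ^ count_list \<kappa> i)
      else 0)"

text \<open>\<open>hl_Q t b n \<kappa> \<mu>\<close> is \<open>Q\<^bsub>\<kappa>/\<mu>\<^esub>(b\<^sub>1, \<dots>, b\<^sub>n)\<close>: skew Hall--Littlewood functions of several variables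
  are given by the branching rule
  \<open>Q\<^bsub>\<kappa>/\<mu>\<^esub>(b\<^sub>1, \<dots>, b\<^sub>n) = \<Sum>\<^sub>\<nu> Q\<^bsub>\<kappa>/\<nu>\<^esub>(b\<^sub>n) Q\<^bsub>\<nu>/\<mu>\<^esub>(b\<^sub>1, \<dots>, b\<^bsub>n-1\<^esub>)\<close>, where only the finitely many \<open>\<nu>\<close>
  interlacing with \<open>\<kappa>\<close> contribute (Macdonald, Chapter III, Section 5).\<close>

primrec hl_Q :: "real \<Rightarrow> (nat \<Rightarrow> real) \<Rightarrow> nat \<Rightarrow> nat list \<Rightarrow> nat list \<Rightarrow> real" where
  "hl_Q t b 0 \<kappa> \<mu> = (if \<kappa> = \<mu> then 1 else 0)"
| "hl_Q t b (Suc n) \<kappa> \<mu> =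
     (\<Sum>\<nu> | is_partition \<nu> \<and> interlaces \<nu> \<kappa>. hl_Q1 t \<kappa> \<nu> (b (Suc n)) * hl_Q t b n \<nu> \<mu>)"

section \<open>The ascending Hall--Littlewood process\<close>

text \<open>A sequence \<open>\<kappa>\<^sup>(\<^sup>1\<^sup>) \<subset> \<dots> \<subset> \<kappa>\<^sup>(\<^sup>M\<^sup>)\<close> is a list \<open>\<Lambda>\<close> of length \<open>M\<close>. Prepending the empty partition
  makes \<open>hl_nth \<Lambda> m\<close> the partition with superscript \<open>m\<close>, for \<open>0 \<le> m \<le> M\<close>.\<close>

definition hl_nth :: "nat list list \<Rightarrow> nat \<Rightarrow> nat list" where
  "hl_nth \<Lambda> m = ([] # \<Lambda>) ! m"

definition partition_seqs :: "nat \<Rightarrow> nat list list set" where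
  "partition_seqs M =
     {\<Lambda>. length \<Lambda> = M \<and> (\<forall>\<kappa>\<in>set \<Lambda>. is_partition \<kappa>) \<and>
         (\<forall>i\<in>{1..<M}. contained (hl_nth \<Lambda> i) (hl_nth \<Lambda> (i + 1)))}"

definition hl_prob ::
    "real \<Rightarrow> (nat \<Rightarrow> real) \<Rightarrow> (nat \<Rightarrow> real) \<Rightarrow> nat \<Rightarrow> nat \<Rightarrow> nat list list \<Rightarrow> real" where
  "hl_prob t a b M N \<Lambda> =
     (\<Prod>i=1..M. hl_P1 t (hl_nth \<Lambda> i) (hl_nth \<Lambda> (i - 1)) (a i)) * hl_Q t b N (hl_nth \<Lambda> M) [] /
     (\<Prod>j=1..N. \<Prod>i=1..M. (1 - t * a i * b j) / (1 - a i * b j))"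

definition hl_process ::
    "real \<Rightarrow> (nat \<Rightarrow> real) \<Rightarrow> (nat \<Rightarrow> real) \<Rightarrow> nat \<Rightarrow> nat \<Rightarrow> nat list list measure" where
  "hl_process t a b M N = point_measure (partition_seqs M) (\<lambda>\<Lambda>. ennreal (hl_prob t a b M N \<Lambda>))"

section \<open>The stochastic six vertex model in the quadrant\<close>

text \<open>\<open>sixv_weight Q z (l, b) (r, u)\<close>, with \<open>z\<close> the product of the spectral parameters of a vertex, is the
  probability that the right and top edges of the vertex have occupations \<open>r\<close> and \<open>u\<close>, given the
  occupations \<open>l\<close> and \<open>b\<close> of its left and bottom edges.\<close>

fun sixv_weight :: "real \<Rightarrow> real \<Rightarrow> bool \<times> bool \<Rightarrow> bool \<times> bool \<Rightarrow> real" where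
  "sixv_weight Q z (False, False) out = (if out = (False, False) then 1 else 0)"
| "sixv_weight Q z (True, True) out = (if out = (True, True) then 1 else 0)"
| "sixv_weight Q z (True, False) out =
     (if out = (True, False) then (1 / Q - z / sqrt Q) / (1 - z / sqrt Q)
      else if out = (False, True) then (1 - 1 / Q) / (1 - z / sqrt Q)
      else 0)"
| "sixv_weight Q z (False, True) out =
     (if out = (False, True) then (1 - sqrt Q * z) / (1 - z / sqrt Q)
      else if out = (True, False) then ((Q - 1) * z / sqrt Q) / (1 - z / sqrt Q)
      else 0)"

definition sixv_pmf :: "real \<Rightarrow> real \<Rightarrow> bool \<times> bool \<Rightarrow> (bool \<times> bool) pmf" where
  "sixv_pmf Q z inp = embed_pmf (sixv_weight Q z inp)"

lemma sixv_weight_nonneg: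
  assumes "0 < Q" "Q < 1" "z > 1 / sqrt Q"
  shows "0 \<le> sixv_weight Q z inp out"
proof -
  have s: "0 < sqrt Q" "sqrt Q * sqrt Q = Q" using assms by auto
  have zs: "z * sqrt Q > 1" using assms(3) s(1) by (simp add: field_simps)
  have z: "z > 0" using assms(3) s(1) by (smt (verit) divide_pos_pos)
  have 1: "z / sqrt Q > 1 / Q"
    using assms(3) s by (smt (verit) divide_divide_eq_left divide_strict_right_mono)
  have 2: "1 / Q > 1" using assms by simp
  have 3: "(Q - 1) * z / sqrt Q \<le> 0"
    using assms s z by (simp add: mult_nonpos_nonneg divide_nonpos_pos)
  have D: "1 - z / sqrt Q \<le> 0" using 1 2 by linarith
  have "0 \<le> (1 / Q - z / sqrt Q) / (1 - z / sqrt Q)" "0 \<le> (1 - 1 / Q) / (1 - z / sqrt Q)"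
    "0 \<le> (1 - sqrt Q * z) / (1 - z / sqrt Q)" "0 \<le> ((Q - 1) * z / sqrt Q) / (1 - z / sqrt Q)"
    using 1 2 zs by (intro divide_nonpos_nonpos[OF _ D] 3; simp add: mult.commute)+
  thus ?thesis
    by (cases "(Q, z, inp, out)" rule: sixv_weight.cases) auto
qed

lemma sum_sixv_weight:
  assumes "0 < Q" "Q < 1" "z > 1 / sqrt Q"
  shows "(\<Sum>out\<in>UNIV. sixv_weight Q z inp out) = 1"
proof -
  have s: "0 < sqrt Q" "sqrt Q * sqrt Q = Q" using assms by auto
  have "z / sqrt Q > 1 / Q"
    using assms(3) s by (smt (verit) divide_divide_eq_left divide_strict_right_mono)
  moreover have "1 / Q > 1" using assms by simp
  ultimately have ne: "1 - z / sqrt Q \<noteq> 0" by linarith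
  have e: "sqrt Q * z = Q * z / sqrt Q" using s by (simp add: field_simps)
  have U: "(UNIV :: (bool \<times> bool) set) = {(False,False),(False,True),(True,False),(True,True)}"
    by auto
  have 1: "(1 - 1 / Q) / (1 - z / sqrt Q) + (1 / Q - z / sqrt Q) / (1 - z / sqrt Q) = 1"
    using ne by (simp add: add_divide_distrib[symmetric])
  have "(1 - sqrt Q * z) + (Q - 1) * z / sqrt Q = 1 - z / sqrt Q"
    unfolding e by (simp add: diff_divide_distrib left_diff_distrib)
  hence 2: "(1 - sqrt Q * z) / (1 - z / sqrt Q) + ((Q - 1) * z / sqrt Q) / (1 - z / sqrt Q) = 1"
    by (simp only: add_divide_distrib[symmetric] divide_self[OF ne])
  show ?thesis
    using 1 2 unfolding U
    by (cases "(Q, z, inp, (True, True))" rule: sixv_weight.cases) auto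
qed

lemma pmf_sixv_pmf:
  assumes "0 < Q" "Q < 1" "z > 1 / sqrt Q"
  shows "pmf (sixv_pmf Q z inp) out = sixv_weight Q z inp out"
  unfolding sixv_pmf_def
proof (rule pmf_embed_pmf)
  show "(\<integral>\<^sup>+ x. ennreal (sixv_weight Q z inp x) \<partial>count_space UNIV) = 1"
    using sixv_weight_nonneg[OF assms] sum_sixv_weight[OF assms]
    by (simp add: nn_integral_count_space_finite sum_ennreal)
qed (rule sixv_weight_nonneg[OF assms])

text \<open>A sample point \<open>\<omega>\<close> provides, independently for every vertex \<open>(x, y)\<close> and every possible pair \<open>i\<close>
  of incoming occupations, a pair \<open>\<omega> ((x, y), i)\<close> of outgoing (right, top) occupations with the law
  prescribed for \<open>i\<close>. The configuration is built by letting every vertex use the entry belonging to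
  its actual incoming occupations, which are functions of the entries at vertices with smaller
  coordinate sum. Thus, conditionally on its incoming edges, the outgoing edges of a vertex are
  sampled with the prescribed probabilities, independently of everything sampled before.\<close>

definition sixv_index :: "((nat \<times> nat) \<times> (bool \<times> bool)) set" where
  "sixv_index = ({1..} \<times> {1..}) \<times> UNIV"

definition sixv_measure ::
    "real \<Rightarrow> (nat \<Rightarrow> real) \<Rightarrow> (nat \<Rightarrow> real) \<Rightarrow> ((nat \<times> nat) \<times> (bool \<times> bool) \<Rightarrow> bool \<times> bool) measure"
  where
  "sixv_measure Q \<xi> u = (\<Pi>\<^sub>M ((x, y), i)\<in>sixv_index. measure_pmf (sixv_pmf Q (\<xi> x * u y) i))"

text \<open>Occupation of the left and the bottom edge of the vertex \<open>(x, y)\<close>, meaningful for \<open>x, y \<ge> 1\<close>.\<close>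

function left_edge bottom_edge ::
    "((nat \<times> nat) \<times> (bool \<times> bool) \<Rightarrow> bool \<times> bool) \<Rightarrow> nat \<Rightarrow> nat \<Rightarrow> bool" where
  "left_edge \<omega> x y =
     (if x \<le> 1 then True
      else fst (\<omega> ((x - 1, y), (left_edge \<omega> (x - 1) y, bottom_edge \<omega> (x - 1) y))))"
| "bottom_edge \<omega> x y =
     (if y \<le> 1 then False
      else snd (\<omega> ((x, y - 1), (left_edge \<omega> x (y - 1), bottom_edge \<omega> x (y - 1)))))"
  by pat_completeness auto
termination
  by (relation "Wellfounded.measure (\<lambda>s. case s of Inl (\<omega>, x, y) \<Rightarrow> x + y | Inr (\<omega>, x, y) \<Rightarrow> x + y)") auto

declare left_edge.simps [simp del] bottom_edge.simps [simp del]

definition sixv_height ::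
    "((nat \<times> nat) \<times> (bool \<times> bool) \<Rightarrow> bool \<times> bool) \<Rightarrow> nat \<Rightarrow> nat \<Rightarrow> nat" where
  "sixv_height \<omega> x y = card {y'\<in>{1..y}. left_edge \<omega> x y'}"

lemma prob_space_sixv_measure: "prob_space (sixv_measure Q \<xi> u)"
  unfolding sixv_measure_def
  by (intro prob_space_PiM) (auto simp: prob_space_measure_pmf split: prod.splits)

lemma measurable_sixv_component:
  assumes "v \<in> sixv_index"
  shows "(\<lambda>\<omega>. \<omega> v) \<in> measurable (sixv_measure Q \<xi> u) (count_space UNIV)"
proof -
  let ?N = "(\<lambda>((x, y), i). measure_pmf (sixv_pmf Q (\<xi> x * u y) i)) v"
  have "(\<lambda>\<omega>. \<omega> v) \<in> measurable (sixv_measure Q \<xi> u) ?N"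
    unfolding sixv_measure_def by (rule measurable_component_singleton[OF assms])
  thus ?thesis
    by (subst measurable_cong_sets[OF refl, of _ ?N]) (auto split: prod.splits)
qed

lemma measurable_edges:
  assumes "1 \<le> x" "1 \<le> y"
  shows "(\<lambda>\<omega>. (left_edge \<omega> x y, bottom_edge \<omega> x y))
           \<in> measurable (sixv_measure Q \<xi> u) (count_space UNIV)"
  using assms
proof (induction "x + y" arbitrary: x y rule: less_induct)
  case less
  let ?M = "sixv_measure Q \<xi> u" and ?B = "count_space (UNIV :: (bool \<times> bool) set)"
  let ?e = "\<lambda>x y \<omega>. (left_edge \<omega> x y, bottom_edge \<omega> x y)"
  have step: "(\<lambda>\<omega>. \<omega> ((x', y'), ?e x' y' \<omega>)) \<in> measurable ?M ?B"
    if "x' + y' < x + y" "1 \<le> x'" "1 \<le> y'" for x' y'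
  proof (rule measurable_compose_countable[where f = "\<lambda>i \<omega>. \<omega> ((x', y'), i)" and g = "?e x' y'"])
    show "(\<lambda>\<omega>. \<omega> ((x', y'), i)) \<in> measurable ?M ?B" for i
      by (rule measurable_sixv_component) (use that in \<open>auto simp: sixv_index_def\<close>)
    show "?e x' y' \<in> measurable ?M ?B" by (rule less.hyps) (use that in auto)
  qed
  have l: "(\<lambda>\<omega>. left_edge \<omega> x y) \<in> measurable ?M (count_space UNIV)"
  proof (cases "x = 1")
    case True
    thus ?thesis by (simp add: left_edge.simps)
  next
    case False
    have "(\<lambda>\<omega>. fst (\<omega> ((x - 1, y), ?e (x - 1) y \<omega>))) \<in> measurable ?M (count_space UNIV)"
      by (rule measurable_compose[OF step]) (use False less.prems in auto)
    thus ?thesis using False less.prems by (subst left_edge.simps) simp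
  qed
  have b: "(\<lambda>\<omega>. bottom_edge \<omega> x y) \<in> measurable ?M (count_space UNIV)"
  proof (cases "y = 1")
    case True
    thus ?thesis by (simp add: bottom_edge.simps)
  next
    case False
    have "(\<lambda>\<omega>. snd (\<omega> ((x, y - 1), ?e x (y - 1) \<omega>))) \<in> measurable ?M (count_space UNIV)"
      by (rule measurable_compose[OF step]) (use False less.prems in auto)
    thus ?thesis using False less.prems by (subst bottom_edge.simps) simp
  qed
  show ?case
    by (rule measurable_compose_countable[where f = "\<lambda>c \<omega>. (c, bottom_edge \<omega> x y)", OF _ l])
       (rule measurable_compose[OF b], simp)
qed

lemma measurable_sixv_height:
  assumes "1 \<le> x"
  shows "(\<lambda>\<omega>. sixv_height \<omega> x y) \<in> measurable (sixv_measure Q \<xi> u) (count_space UNIV)"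
proof -
  let ?M = "sixv_measure Q \<xi> u"
  have l: "(\<lambda>\<omega>. left_edge \<omega> x y') \<in> measurable ?M (count_space UNIV)" if "1 \<le> y'" for y'
    using measurable_compose[OF measurable_edges[OF assms that], of fst] by simp
  have "sixv_height \<omega> x y = (\<Sum>y'\<in>{1..y}. if left_edge \<omega> x y' then 1 else 0)" for \<omega>
    by (simp add: sixv_height_def sum.If_cases Int_def)
  moreover have "(\<lambda>\<omega>. \<Sum>y'\<in>{1..y}. if left_edge \<omega> x y' then 1 else (0::nat))
      \<in> measurable ?M (count_space UNIV)"
  proof (induction y)
    case (Suc y)
    note [measurable] = l[of "Suc y", simplified] Suc
    have "(\<lambda>\<omega>. (\<Sum>y'\<in>{1..y}. if left_edge \<omega> x y' then 1 else 0) +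
            (if left_edge \<omega> x (Suc y) then 1 else (0::nat))) \<in> measurable ?M (count_space UNIV)"
      by measurable
    thus ?case by simp
  qed simp
  ultimately show ?thesis by simp
qed

end

theory Submission
  imports Defs
begin

text \<open>Write \<open>\<ell>(x, y)\<close> for \<open>y - h(x + 1, y)\<close>. A row of the six vertex model is a Markov step from
  \<open>(\<ell>(x, y))\<^sub>x\<close> to \<open>(\<ell>(x, y + 1))\<^sub>x\<close>, in which every vertex depends on the four values of \<open>\<ell>\<close> around it.
  The Hall--Littlewood side makes the same step when a variable \<open>b\<^bsub>N+1\<^esub>\<close> is split off \<open>Q\<close> and moved
  through the chain of \<open>P\<close>'s by the skew Cauchy identity. That identity can be refined by lengths:
  \[\sum_{\ell(\tau) = r} P_{\tau/\kappa}(a) Q_{\tau/\mu}(b) = \frac{1 - tab}{1 - ab}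
    \sum_l S(l, \ell(\mu), \ell(\kappa), r) \sum_{\ell(\nu) = l} P_{\mu/\nu}(a) Q_{\kappa/\nu}(b),\]
  where \<open>S\<close> is exactly the six vertex weight. The refined identity reproduces itself when the first
  columns of \<open>\<mu>\<close> and \<open>\<kappa>\<close> are removed, by a Yang--Baxter type relation between the one-column weights
  and \<open>S\<close>, so it follows by induction on \<open>|\<mu>| + |\<kappa>|\<close> from the geometric series at \<open>\<mu> = \<kappa> = \<emptyset>\<close>.\<close>

section \<open>Removing the first column\<close>

text \<open>S depends on four lengths only, not on the partitions behind them. Once the sums are
  refined by lengths, S can therefore be taken out of them, and moving one b through P(a_1), ...,
  P(a_M) leaves behind one S for each a_x, that is, one row of vertices. The unrefined identity
  would yield only the normalising constant.

  Columns suit this refinement: interlacing says that corresponding column lengths differ by at most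
  one, and the multiplicity of the part i is the difference of the column lengths i and i + 1. So
  the first column enters a one-variable P or Q through a power and one factor in the lengths of the
  first two columns. The price is that second column lengths become new summation variables, and S
  in these lengths must be exchanged for S in the first ones.

  On the vertex side the obstacle is that a vertex consults the sample entry of its random inputs.
  Fixing the whole history of rows makes all inputs known and leaves an event about independent
  coordinates. Both laws become the same sum over histories with a given last row.\<close>

definition addcol :: "nat \<Rightarrow> nat list \<Rightarrow> nat list" where
  "addcol n \<rho> = map Suc \<rho> @ replicate (n - length \<rho>) 1"

text \<open>Removing the first column deletes the parts equal to 1. \<open>addcol n\<close> puts
  them back by padding with 1s, so it inverts \<open>dropcol\<close> when n is the original number
  of parts.\<close>

definition dropcol :: "nat list \<Rightarrow> nat list" where
  "dropcol \<kappa> = map (\<lambda>x. x - 1) (filter (\<lambda>x. 1 < x) \<kappa>)"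

definition partitions_of_length :: "nat \<Rightarrow> nat list set" where
  "partitions_of_length r = {\<kappa>. is_partition \<kappa> \<and> length \<kappa> = r}"

lemma length_addcol: "length \<rho> \<le> n \<Longrightarrow> length (addcol n \<rho>) = n"
  by (simp add: addcol_def)

lemma sum_list_addcol: "length \<rho> \<le> n \<Longrightarrow> sum_list (addcol n \<rho>) = sum_list \<rho> + n"
  by (simp add: addcol_def sum_list_Suc sum_list_replicate)

lemma nth_default_addcol:
  assumes "length \<rho> \<le> n"
  shows "nth_default 0 (addcol n \<rho>) i = nth_default 0 \<rho> i + (if i < n then 1 else 0)"
  using assms by (auto simp: addcol_def nth_default_def nth_append)

lemma is_partition_addcol: "is_partition \<rho> \<Longrightarrow> is_partition (addcol n \<rho>)"
proof -
  have "sorted_wrt (\<ge>) (replicate k (1::nat))" for k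
    by (induction k) auto
  thus "is_partition \<rho> \<Longrightarrow> is_partition (addcol n \<rho>)"
    by (auto simp: is_partition_def addcol_def sorted_wrt_append sorted_wrt_map)
qed

lemma dropcol_addcol: "is_partition \<rho> \<Longrightarrow> dropcol (addcol n \<rho>) = \<rho>"
  by (auto simp: is_partition_def addcol_def dropcol_def filter_map o_def)
    
lemma length_dropcol: "length (dropcol \<kappa>) \<le> length \<kappa>"
  by (simp add: dropcol_def)

lemma is_partition_dropcol: "is_partition \<kappa> \<Longrightarrow> is_partition (dropcol \<kappa>)"
  by (auto simp: is_partition_def dropcol_def sorted_wrt_map intro: sorted_wrt_filter
      elim!: sorted_wrt_mono_rel[rotated])

lemma addcol_dropcol: "is_partition \<kappa> \<Longrightarrow> addcol (length \<kappa>) (dropcol \<kappa>) = \<kappa>"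
proof (induction \<kappa>)
  case Nil
  then show ?case by (simp add: addcol_def dropcol_def)
next
  case (Cons x \<kappa>)
  have p: "is_partition \<kappa>" "0 < x" "\<forall>y\<in>set \<kappa>. 0 < y \<and> y \<le> x"
    using Cons.prems by (auto simp: is_partition_def)
  show ?case
  proof (cases "1 < x")
    case True
    then show ?thesis using Cons.IH[OF p(1)] by (simp add: addcol_def dropcol_def)
  next
    case False
    hence x: "x = 1" using p by simp
    hence y: "\<forall>y\<in>set \<kappa>. y = 1" using p(3) by auto
    hence "filter (\<lambda>x. 1 < x) \<kappa> = []" "replicate (length \<kappa>) 1 = \<kappa>"
      by (auto simp: filter_empty_conv replicate_length_same)
    then show ?thesis using x by (simp add: addcol_def dropcol_def)
  qed
qed

lemma bij_betw_addcol: "bij_betw (addcol r) {\<rho>. is_partition \<rho> \<and> length \<rho> \<le> r} (partitions_of_length r)"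
proof (rule bij_betw_byWitness[where f' = dropcol])
  show "dropcol ` partitions_of_length r \<subseteq> {\<rho>. is_partition \<rho> \<and> length \<rho> \<le> r}"
    using is_partition_dropcol length_dropcol by (fastforce simp: partitions_of_length_def)
qed (auto simp: partitions_of_length_def dropcol_addcol addcol_dropcol is_partition_addcol length_addcol)

lemma nth_default_ge: "length xs \<le> i \<Longrightarrow> nth_default d xs i = d"
  by (simp add: nth_default_def)

text \<open>Interlacing compares the two diagrams column by column, each pair of lengths differing
  by at most one. A new first column only adds its own instance of this condition.\<close>

lemma interlaces_addcol:
  assumes "length \<rho> \<le> n" "length \<sigma> \<le> k"
  shows "interlaces (addcol n \<rho>) (addcol k \<sigma>) \<longleftrightarrow> interlaces \<rho> \<sigma> \<and> n \<le> k \<and> k \<le> Suc n"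
proof
  assume *: "interlaces (addcol n \<rho>) (addcol k \<sigma>)"
  have 1: "nth_default 0 \<rho> i + (if i < n then 1 else 0) \<le> nth_default 0 \<sigma> i + (if i < k then 1 else 0)"
    and 2: "nth_default 0 \<sigma> (Suc i) + (if Suc i < k then 1 else 0)
              \<le> nth_default 0 \<rho> i + (if i < n then 1 else 0)" for i
    using * by (simp_all only: interlaces_def nth_default_addcol[OF assms(1)] nth_default_addcol[OF assms(2)])
  have nk: "n \<le> k"
    using 1[of k] assms by (auto simp: nth_default_ge split: if_splits)
  have kn: "k \<le> Suc n"
    using 2[of n] assms by (auto simp: nth_default_ge split: if_splits)
  have "nth_default 0 \<rho> i \<le> nth_default 0 \<sigma> i" for i
    using 1[of i] nk assms by (cases "i < n") (auto simp: nth_default_ge)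
  moreover have "nth_default 0 \<sigma> (Suc i) \<le> nth_default 0 \<rho> i" for i
    using 2[of i] assms by (cases "Suc i < k") (auto simp: nth_default_ge split: if_splits)
  ultimately show "interlaces \<rho> \<sigma> \<and> n \<le> k \<and> k \<le> Suc n"
    using nk kn by (simp add: interlaces_def)
next
  assume "interlaces \<rho> \<sigma> \<and> n \<le> k \<and> k \<le> Suc n"
  thus "interlaces (addcol n \<rho>) (addcol k \<sigma>)"
    by (auto simp: interlaces_def nth_default_addcol[OF assms(1)] nth_default_addcol[OF assms(2)]
        le_SucI)
qed

lemma sum_list_nth_default: "length xs \<le> L \<Longrightarrow> sum_list xs = (\<Sum>i<L. nth_default 0 xs i)"
proof (induction xs arbitrary: L)
  case Nil
  then show ?case by simp
next
  case (Cons x xs)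
  then obtain L' where L: "L = Suc L'" "length xs \<le> L'" by (cases L) auto
  show ?case unfolding L(1) sum.lessThan_Suc_shift using Cons.IH[OF L(2)] by simp
qed

lemma contained_sum_list_le:
  assumes "contained \<mu> \<kappa>"
  shows "sum_list \<mu> \<le> sum_list \<kappa>"
  using assms
  by (auto simp: sum_list_nth_default[of _ "max (length \<mu>) (length \<kappa>)"] contained_def intro!: sum_mono)


section \<open>Multiplicities and the column factors of P and Q in one variable\<close>

lemma count_list_replicate': "count_list (replicate n x) y = (if x = y then n else 0)"
  by (induction n) auto

lemma count_list_map_Suc: "count_list (map Suc \<rho>) (Suc i) = count_list \<rho> i"
  by (induction \<rho>) auto

lemma count_list_addcol:
  assumes "is_partition \<rho>"
  shows "count_list (addcol n \<rho>) (Suc i) = (if i = 0 then n - length \<rho> else count_list \<rho> i)"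
proof -
  have "count_list \<rho> 0 = 0"
    using assms by (auto simp: count_list_0_iff is_partition_def)
  thus ?thesis by (simp add: addcol_def count_list_append count_list_replicate' count_list_map_Suc)
qed

text \<open>Like \<open>colQ\<close>, the factor of a single part size, with m' its multiplicity in
  the outer and m in the inner partition. It is applied to the part size 1, whose multiplicity is
  the first column length minus the second.\<close>

definition colP :: "real \<Rightarrow> nat \<Rightarrow> nat \<Rightarrow> real" where
  "colP t m' m = (if m' + 1 = m then 1 - t ^ m else 1)"

definition colQ :: "real \<Rightarrow> nat \<Rightarrow> nat \<Rightarrow> real" where
  "colQ t m' m = (if m' = m + 1 then 1 - t ^ m' else 1)"

text \<open>Adding a column turns parts i into parts i + 1, so splitting off the index 1 leaves the
  product for the smaller partitions.\<close>

lemma prod_shift_1: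
  fixes f :: "nat \<Rightarrow> real"
  assumes "finite {i. 1 \<le> i \<and> R i}"
  shows "(\<Prod>i | 1 \<le> i \<and> R i. f i) = (if R 1 then f 1 else 1) * (\<Prod>i | 1 \<le> i \<and> R (Suc i). f (Suc i))"
proof -
  have eq: "{i. 1 \<le> i \<and> R i} = (if R 1 then {1} else {}) \<union> Suc ` {i. 1 \<le> i \<and> R (Suc i)}" (is "_ = ?A \<union> ?B")
  proof safe
    fix i assume "1 \<le> i" "R i" "i \<notin> Suc ` {i. 1 \<le> i \<and> R (Suc i)}"
    thus "i \<in> ?A" by (cases i; cases "i - 1") auto
  qed (auto split: if_splits)
  have fin: "finite ?B" by (rule finite_subset[OF _ assms]) auto
  have "(\<Prod>i | 1 \<le> i \<and> R i. f i) = prod f ?A * prod f ?B"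
    unfolding eq by (rule prod.union_disjoint) (use fin in auto)
  also have "prod f ?B = (\<Prod>i | 1 \<le> i \<and> R (Suc i). f (Suc i))"
    by (subst prod.reindex) auto
  finally show ?thesis by simp
qed

lemma finite_count_list_pos: "(\<And>i. R i \<Longrightarrow> 0 < count_list xs i) \<Longrightarrow> finite {i. 1 \<le> i \<and> R i}"
  by (rule finite_subset[of _ "set xs"]) (auto, metis count_notin less_numeral_extra(3))

lemma hl_P1_addcol:
  assumes "is_partition \<rho>" "is_partition \<sigma>" "length \<rho> \<le> n" "length \<sigma> \<le> k"
  shows "hl_P1 t (addcol k \<sigma>) (addcol n \<rho>) a =
    (if n \<le> k \<and> k \<le> Suc n then a ^ (k - n) * colP t (k - length \<sigma>) (n - length \<rho>) else 0) * hl_P1 t \<sigma> \<rho> a"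
proof (cases "interlaces \<rho> \<sigma> \<and> n \<le> k \<and> k \<le> Suc n")
  case False
  thus ?thesis unfolding hl_P1_def interlaces_addcol[OF assms(3,4)] by auto
next
  case True
  \<comment> \<open>Exponents use truncated subtraction; this bound lets the new exponent split into
    the old one plus k - n.\<close>
  hence le: "sum_list \<rho> \<le> sum_list \<sigma>" by (intro contained_sum_list_le interlaces_imp_contained) simp
  have "(\<Prod>i | 1 \<le> i \<and> count_list (addcol k \<sigma>) i + 1 = count_list (addcol n \<rho>) i. 1 - t ^ count_list (addcol n \<rho>) i)
    = colP t (k - length \<sigma>) (n - length \<rho>) *
      (\<Prod>i | 1 \<le> i \<and> count_list \<sigma> i + 1 = count_list \<rho> i. 1 - t ^ count_list \<rho> i)"
    by (subst prod_shift_1, rule finite_count_list_pos[of _ "addcol n \<rho>"], simp)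
       (auto simp: count_list_addcol assms colP_def intro!: prod.cong)
  thus ?thesis using True le unfolding hl_P1_def interlaces_addcol[OF assms(3,4)]
    by (simp add: sum_list_addcol assms power_add[symmetric] add.commute)
qed

lemma hl_Q1_addcol:
  assumes "is_partition \<rho>" "is_partition \<sigma>" "length \<rho> \<le> n" "length \<sigma> \<le> k"
  shows "hl_Q1 t (addcol k \<sigma>) (addcol n \<rho>) a =
    (if n \<le> k \<and> k \<le> Suc n then a ^ (k - n) * colQ t (k - length \<sigma>) (n - length \<rho>) else 0) * hl_Q1 t \<sigma> \<rho> a"
proof (cases "interlaces \<rho> \<sigma> \<and> n \<le> k \<and> k \<le> Suc n")
  case False
  thus ?thesis unfolding hl_Q1_def interlaces_addcol[OF assms(3,4)] by auto
next
  case True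
  hence le: "sum_list \<rho> \<le> sum_list \<sigma>" by (intro contained_sum_list_le interlaces_imp_contained) simp
  have "(\<Prod>i | 1 \<le> i \<and> count_list (addcol k \<sigma>) i = count_list (addcol n \<rho>) i + 1. 1 - t ^ count_list (addcol k \<sigma>) i)
    = colQ t (k - length \<sigma>) (n - length \<rho>) *
      (\<Prod>i | 1 \<le> i \<and> count_list \<sigma> i = count_list \<rho> i + 1. 1 - t ^ count_list \<sigma> i)"
    by (subst prod_shift_1, rule finite_count_list_pos[of _ "addcol k \<sigma>"], simp)
       (auto simp: count_list_addcol assms colQ_def intro!: prod.cong)
  thus ?thesis using True le unfolding hl_Q1_def interlaces_addcol[OF assms(3,4)]
    by (simp add: sum_list_addcol assms power_add[symmetric] add.commute)
qed

lemma hl_P1_nonneg: "0 \<le> t \<Longrightarrow> t \<le> 1 \<Longrightarrow> 0 \<le> a \<Longrightarrow> 0 \<le> hl_P1 t \<kappa> \<mu> a"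
  by (auto simp: hl_P1_def power_le_one intro!: prod_nonneg mult_nonneg_nonneg)

lemma hl_Q1_nonneg: "0 \<le> t \<Longrightarrow> t \<le> 1 \<Longrightarrow> 0 \<le> b \<Longrightarrow> 0 \<le> hl_Q1 t \<kappa> \<mu> b"
  by (auto simp: hl_Q1_def power_le_one simp del: power_Suc intro!: prod_nonneg mult_nonneg_nonneg)

section \<open>The refined skew Cauchy identity\<close>

text \<open>\<open>vertex_weight t p l n k r\<close> is the six vertex weight with \<open>l\<close>, \<open>n\<close>, \<open>k\<close>, \<open>r\<close> the values of \<open>\<ell>\<close> at
  the lower left, lower right, upper left and upper right of the vertex, and \<open>p = a\<^sub>x b\<^sub>y\<close>.\<close>

definition vertex_weight :: "real \<Rightarrow> real \<Rightarrow> nat \<Rightarrow> nat \<Rightarrow> nat \<Rightarrow> nat \<Rightarrow> real" where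
  "vertex_weight t p l n k r =
     (if n = l \<and> k = l then
        (if r = l then (1 - p) / (1 - t * p) else if r = l + 1 then p * (1 - t) / (1 - t * p) else 0)
      else if n = l + 1 \<and> k = l + 1 then
        (if r = l + 1 then (1 - t) / (1 - t * p) else if r = l + 2 then t * (1 - p) / (1 - t * p) else 0)
      else if (n = l + 1 \<and> k = l \<or> n = l \<and> k = l + 1) \<and> r = l + 1 then 1 else 0)"

text \<open>The extra factor is the Cauchy kernel of the pair of variables with product p. It clears
  the prefactor from the refined identity and later accounts for the normalisation of the
  process.\<close>

definition cauchy_weight :: "real \<Rightarrow> real \<Rightarrow> nat \<Rightarrow> nat \<Rightarrow> nat \<Rightarrow> nat \<Rightarrow> real" where
  "cauchy_weight t p l n k r = (1 - t * p) / (1 - p) * vertex_weight t p l n k r"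

lemma cauchy_weight_eq:
  assumes "p \<noteq> 1" "t * p \<noteq> 1"
  shows "cauchy_weight t p l n k r = 
     (if n = l \<and> k = l then
        (if r = l then 1 else if r = l + 1 then p * (1 - t) / (1 - p) else 0)
      else if n = l + 1 \<and> k = l + 1 then
        (if r = l + 1 then (1 - t) / (1 - p) else if r = l + 2 then t else 0)
      else if (n = l + 1 \<and> k = l \<or> n = l \<and> k = l + 1) \<and> r = l + 1 then (1 - t * p) / (1 - p) else 0)"
  using assms by (auto simp: cauchy_weight_def vertex_weight_def)

text \<open>Column factors of \<open>P\<^bsub>\<tau>/\<kappa>\<^esub>(a) Q\<^bsub>\<tau>/\<mu>\<^esub>(b)\<close> and \<open>P\<^bsub>\<mu>/\<nu>\<^esub>(a) Q\<^bsub>\<kappa>/\<nu>\<^esub>(b)\<close>: the first columns of \<open>\<mu>\<close>,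
  \<open>\<kappa>\<close>, \<open>\<tau>\<close>, \<open>\<nu>\<close> have lengths \<open>n\<close>, \<open>k\<close>, \<open>r\<close>, \<open>l\<close>, the second ones are primed.\<close>

definition upper_col where
  "upper_col t a b n k n' k' r r' = 
    (if r' \<le> r \<and> n \<le> r \<and> r \<le> Suc n \<and> k \<le> r \<and> r \<le> Suc k then
      a ^ (r - k) * colP t (r - r') (k - k') * (b ^ (r - n) * colQ t (r - r') (n - n')) else (0::real))"

definition lower_col where
  "lower_col t a b n k n' k' l l' = 
    (if l' \<le> l \<and> l \<le> n \<and> n \<le> Suc l \<and> l \<le> k \<and> k \<le> Suc l then
      a ^ (n - l) * colP t (n - n') (l - l') * (b ^ (k - l) * colQ t (k - k') (l - l')) else (0::real))"

text \<open>The Yang--Baxter relation. The left side sums over \<open>r'\<close>, the right side over \<open>l \<in> {n - 1, n}\<close>;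
  the conditional avoids counting \<open>l = 0\<close> twice when \<open>n = 0\<close>.\<close>

lemma column_exchange:
  assumes ab: "a * b \<noteq> 1" "t * (a * b) \<noteq> 1"
    and n': "n' = l' \<or> n' = Suc l'" and k': "k' = l' \<or> k' = Suc l'"
    and n: "r = n \<or> r = Suc n" and k: "r = k \<or> r = Suc k"
    and le: "n' \<le> n" "k' \<le> k"
  shows "upper_col t a b n k n' k' r l' * cauchy_weight t (a * b) l' n' k' l'
       + upper_col t a b n k n' k' r (Suc l') * cauchy_weight t (a * b) l' n' k' (Suc l')
       + upper_col t a b n k n' k' r (Suc (Suc l')) * cauchy_weight t (a * b) l' n' k' (Suc (Suc l'))
       = cauchy_weight t (a * b) n n k r * lower_col t a b n k n' k' n l'
       + (if n = 0 then 0 else cauchy_weight t (a * b) (n - 1) n k r * lower_col t a b n k n' k' (n - 1) l')"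
proof -
  have "l' \<le> r" using n' n le by auto
  then obtain q where r: "r = q + l'" using le_Suc_ex by (metis add.commute)
  \<comment> \<open>With q = r - l', all multiplicities in the column factors are q minus at most 2.
    Small q, where side conditions or truncated subtraction can interfere, are treated one by one;
    the rest is one rational identity in a, b, t and a power of t.\<close>
  have q: "q = 0 \<or> q = Suc 0 \<or> q = Suc (Suc 0) \<or> q = Suc (Suc (Suc 0)) \<or> (\<exists>i. q = Suc (Suc (Suc (Suc i))))"
    by presburger
  have pow: "t ^ 2 = t * t" "t ^ 3 = t * (t * t)" "t ^ (i + 3) = t * (t * (t * t ^ i))"
    "t ^ (i + 4) = t * (t * (t * (t * t ^ i)))" for i
    by (simp_all add: numeral_eq_Suc)
  note s = lower_col_def upper_col_def cauchy_weight_eq[OF ab] colP_def colQ_def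
  show ?thesis
  proof (cases q)
    case 0
    hence "n = l'" "k = l'" "n' = l'" "k' = l'" "r = l'" using n k n' k' le r by auto
    thus ?thesis by (cases l') (simp_all add: s)
  next
    case (Suc j)
    hence n2: "n = Suc (j + l') \<or> n = j + l'" and k2: "k = Suc (j + l') \<or> k = j + l'"
      and j: "j = 0 \<or> j = Suc 0 \<or> j = Suc (Suc 0) \<or> (\<exists>i. j = Suc (Suc (Suc i)))"
      using n k q unfolding r by auto
    show ?thesis
      unfolding r Suc
      by (insert le n' k' n2 k2 j, elim disjE exE; hypsubst_thin; simp add: s; (use ab in \<open>simp add: field_simps\<close>)?; simp add: pow)
  qed
qed

section \<open>Sums over partitions as integrals against counting measures\<close>

lemma nsum_swap:
  "(\<integral>\<^sup>+x. (\<integral>\<^sup>+y. f x y \<partial>count_space B) \<partial>count_space A) = (\<integral>\<^sup>+y. (\<integral>\<^sup>+x. f x y \<partial>count_space A) \<partial>count_space B)"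
proof -
  \<comment> \<open>Indicators extend both sums to the full types, where Tonelli for counting
    measures applies. Values in \<open>ennreal\<close> avoid all summability conditions.\<close>
  let ?g = "\<lambda>(x, y). f x y * indicator A x * indicator B y"
  have "(\<integral>\<^sup>+x. (\<integral>\<^sup>+y. f x y \<partial>count_space B) \<partial>count_space A)
      = (\<integral>\<^sup>+x. (\<integral>\<^sup>+y. ?g (x, y) \<partial>count_space UNIV) \<partial>count_space UNIV)"
    by (subst (1 2) nn_integral_count_space_indicator)
       (auto simp: nn_integral_cmult[symmetric] nn_integral_multc[symmetric] ac_simps intro!: nn_integral_cong)
  also have "\<dots> = (\<integral>\<^sup>+y. (\<integral>\<^sup>+x. ?g (x, y) \<partial>count_space UNIV) \<partial>count_space UNIV)"
    by (simp only: nn_integral_fst_count_space nn_integral_snd_count_space)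
  also have "\<dots> = (\<integral>\<^sup>+y. (\<integral>\<^sup>+x. f x y \<partial>count_space A) \<partial>count_space B)"
    by (subst (3 4) nn_integral_count_space_indicator)
       (auto simp: nn_integral_cmult[symmetric] nn_integral_multc[symmetric] ac_simps intro!: nn_integral_cong)
  finally show ?thesis .
qed

lemma nsum_fibre:
  "(\<integral>\<^sup>+x. f x \<partial>count_space A) = (\<integral>\<^sup>+r. (\<integral>\<^sup>+x. f x \<partial>count_space {x\<in>A. g x = r}) \<partial>count_space UNIV)"
proof -
  have "(\<integral>\<^sup>+r. (\<integral>\<^sup>+x. f x \<partial>count_space {x\<in>A. g x = r}) \<partial>count_space UNIV)
      = (\<integral>\<^sup>+r. (\<integral>\<^sup>+x. f x * indicator {g x} r \<partial>count_space A) \<partial>count_space UNIV)"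
    by (subst (1 3) nn_integral_count_space_indicator) (auto intro!: nn_integral_cong simp: indicator_def)
  also have "\<dots> = (\<integral>\<^sup>+x. (\<integral>\<^sup>+r. f x * indicator {g x} r \<partial>count_space UNIV) \<partial>count_space A)"
    by (rule nsum_swap)
  also have "\<dots> = (\<integral>\<^sup>+x. f x \<partial>count_space A)"
    by (simp add: nn_integral_cmult)
  finally show ?thesis by simp
qed

text \<open>Partitions of length r are grouped by the length s of their second column. The bound on
  s sits in the integrand, so the outer sum has a range independent of r.\<close>

lemma nsum_addcol:
  "(\<integral>\<^sup>+\<kappa>. f \<kappa> \<partial>count_space (partitions_of_length r))
   = (\<integral>\<^sup>+s. (\<integral>\<^sup>+\<rho>. (if s \<le> r then f (addcol r \<rho>) else 0) \<partial>count_space (partitions_of_length s)) \<partial>count_space UNIV)"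
proof -
  have "(\<integral>\<^sup>+\<kappa>. f \<kappa> \<partial>count_space (partitions_of_length r))
      = (\<integral>\<^sup>+\<rho>. f (addcol r \<rho>) \<partial>count_space {\<rho>. is_partition \<rho> \<and> length \<rho> \<le> r})"
    by (rule nn_integral_bij_count_space[OF bij_betw_addcol, symmetric])
  also have "\<dots> = (\<integral>\<^sup>+\<rho>. (if length \<rho> \<le> r then f (addcol r \<rho>) else 0) \<partial>count_space {\<rho>. is_partition \<rho>})"
    by (subst (1 2) nn_integral_count_space_indicator) (auto intro!: nn_integral_cong simp: indicator_def)
  also have "\<dots> = (\<integral>\<^sup>+s. (\<integral>\<^sup>+\<rho>. (if length \<rho> \<le> r then f (addcol r \<rho>) else 0) \<partial>count_space (partitions_of_length s)) \<partial>count_space UNIV)"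
    by (subst nsum_fibre[where g = length]) (simp add: partitions_of_length_def)
  also have "\<dots> = (\<integral>\<^sup>+s. (\<integral>\<^sup>+\<rho>. (if s \<le> r then f (addcol r \<rho>) else 0) \<partial>count_space (partitions_of_length s)) \<partial>count_space UNIV)"
    by (intro nn_integral_cong) (auto simp: partitions_of_length_def)
  finally show ?thesis .
qed

text \<open>Every partition is \<open>addcol\<close> of its own first column, so the bounds are the
  column part of \<open>interlaces_addcol\<close>.\<close>

lemma interlaces_length:
  assumes "interlaces \<mu> \<kappa>" "is_partition \<mu>" "is_partition \<kappa>"
  shows "length \<mu> \<le> length \<kappa>" "length \<kappa> \<le> Suc (length \<mu>)"
proof -
  have "interlaces (addcol (length \<mu>) (dropcol \<mu>)) (addcol (length \<kappa>) (dropcol \<kappa>))"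
    using assms by (simp add: addcol_dropcol)
  thus "length \<mu> \<le> length \<kappa>" "length \<kappa> \<le> Suc (length \<mu>)"
    by (auto simp: interlaces_addcol length_dropcol)
qed

lemma partitions_of_length_0: "partitions_of_length 0 = {[]}"
  by (auto simp: partitions_of_length_def is_partition_def)

section \<open>The induction on columns\<close>

locale hl_params =
  fixes t a b :: real
  assumes t: "0 \<le> t" "t \<le> 1" and ab: "0 \<le> a" "0 \<le> b" "a * b < 1"
begin

lemma ab_bounds: "a * b \<noteq> 1" "t * (a * b) \<noteq> 1" "0 \<le> a * b" "t * (a * b) < 1"
proof -
  show "0 \<le> a * b" using ab by simp
  then have "t * (a * b) \<le> 1 * (a * b)" using t by (intro mult_right_mono) auto
  thus "t * (a * b) < 1" using ab by simp
  thus "a * b \<noteq> 1" "t * (a * b) \<noteq> 1" using ab by auto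
qed

definition upper_sum :: "nat list \<Rightarrow> nat list \<Rightarrow> nat \<Rightarrow> ennreal" where
  "upper_sum \<mu> \<kappa> r = (\<integral>\<^sup>+\<tau>. ennreal (hl_P1 t \<tau> \<kappa> a * hl_Q1 t \<tau> \<mu> b) \<partial>count_space (partitions_of_length r))"

definition lower_sum :: "nat list \<Rightarrow> nat list \<Rightarrow> nat \<Rightarrow> ennreal" where
  "lower_sum \<mu> \<kappa> l = (\<integral>\<^sup>+\<nu>. ennreal (hl_P1 t \<mu> \<nu> a * hl_Q1 t \<kappa> \<nu> b) \<partial>count_space (partitions_of_length l))"

lemma colPQ_nonneg: "0 \<le> colP t x y" "0 \<le> colQ t x y"
  using t by (auto simp: colP_def colQ_def power_le_one simp del: power_Suc)

lemma upper_col_nonneg: "0 \<le> upper_col t a b n k n' k' r r'"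
  using ab colPQ_nonneg by (auto simp: upper_col_def)

lemma lower_col_nonneg: "0 \<le> lower_col t a b n k n' k' r r'"
  using ab colPQ_nonneg by (auto simp: lower_col_def)

lemma cauchy_weight_nonneg: "0 \<le> cauchy_weight t (a * b) l n k r"
  using ab_bounds ab t unfolding cauchy_weight_eq[OF ab_bounds(1,2)] by (auto intro!: divide_nonneg_nonneg mult_nonneg_nonneg)

lemma lower_sum_eq_0:
  assumes "is_partition \<mu>" "is_partition \<kappa>"
    "\<not> ((length \<mu> = l \<or> length \<mu> = Suc l) \<and> (length \<kappa> = l \<or> length \<kappa> = Suc l))"
  shows "lower_sum \<mu> \<kappa> l = 0"
proof -
  have *: "hl_P1 t \<mu> \<nu> a * hl_Q1 t \<kappa> \<nu> b = 0" if "\<nu> \<in> partitions_of_length l" for \<nu>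
    using that assms interlaces_length[of \<nu> \<mu>] interlaces_length[of \<nu> \<kappa>]
    by (auto simp: partitions_of_length_def hl_P1_def hl_Q1_def)
  have "lower_sum \<mu> \<kappa> l = (\<integral>\<^sup>+\<nu>. 0 \<partial>count_space (partitions_of_length l))"
    unfolding lower_sum_def by (intro nn_integral_cong) (auto dest!: *)
  thus ?thesis by simp
qed

text \<open>The factors of the first columns see only lengths. For a fixed second column length r'
  of the summed partition they come out of the sum, which is then the same sum for the smaller
  partitions.\<close>

lemma upper_sum_addcol:
  assumes "is_partition \<rho>" "is_partition \<sigma>" "length \<rho> \<le> n" "length \<sigma> \<le> k"
  shows "upper_sum (addcol n \<rho>) (addcol k \<sigma>) r =
    (\<integral>\<^sup>+r'. ennreal (upper_col t a b n k (length \<rho>) (length \<sigma>) r r') * upper_sum \<rho> \<sigma> r' \<partial>count_space UNIV)"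
  unfolding upper_sum_def nsum_addcol[where r = r]
proof (subst nn_integral_cmult[symmetric], simp, intro nn_integral_cong)
  fix s \<tau> assume "\<tau> \<in> space (count_space (partitions_of_length s))"
  hence \<tau>: "is_partition \<tau>" "length \<tau> = s" by (auto simp: partitions_of_length_def)
  show "(if s \<le> r then ennreal (hl_P1 t (addcol r \<tau>) (addcol k \<sigma>) a * hl_Q1 t (addcol r \<tau>) (addcol n \<rho>) b) else 0)
    = ennreal (upper_col t a b n k (length \<rho>) (length \<sigma>) r s) * ennreal (hl_P1 t \<tau> \<sigma> a * hl_Q1 t \<tau> \<rho> b)"
    by (subst ennreal_mult[symmetric])
       (use t ab \<tau> assms upper_col_nonneg in \<open>auto simp: hl_P1_nonneg hl_Q1_nonneg hl_P1_addcol hl_Q1_addcol upper_col_def mult_ac\<close>)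
qed

lemma lower_sum_addcol:
  assumes "is_partition \<rho>" "is_partition \<sigma>" "length \<rho> \<le> n" "length \<sigma> \<le> k"
  shows "lower_sum (addcol n \<rho>) (addcol k \<sigma>) l =
    (\<integral>\<^sup>+l'. ennreal (lower_col t a b n k (length \<rho>) (length \<sigma>) l l') * lower_sum \<rho> \<sigma> l' \<partial>count_space UNIV)"
  unfolding lower_sum_def nsum_addcol[where r = l]
proof (subst nn_integral_cmult[symmetric], simp, intro nn_integral_cong)
  fix s \<tau> assume "\<tau> \<in> space (count_space (partitions_of_length s))"
  hence \<tau>: "is_partition \<tau>" "length \<tau> = s" by (auto simp: partitions_of_length_def)
  show "(if s \<le> l then ennreal (hl_P1 t (addcol n \<rho>) (addcol l \<tau>) a * hl_Q1 t (addcol k \<sigma>) (addcol l \<tau>) b) else 0)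
    = ennreal (lower_col t a b n k (length \<rho>) (length \<sigma>) l s) * ennreal (hl_P1 t \<rho> \<tau> a * hl_Q1 t \<sigma> \<tau> b)"
    by (subst ennreal_mult[symmetric])
       (use t ab \<tau> assms lower_col_nonneg in \<open>auto simp: hl_P1_nonneg hl_Q1_nonneg hl_P1_addcol hl_Q1_addcol lower_col_def mult_ac\<close>)
qed

text \<open>Both sums have finite support: \<open>cauchy_weight\<close> confines r' to l', l' + 1,
  l' + 2, and \<open>lower_col\<close> confines l to n - 1 and n. If r is not in reach of both n and
  k, both sides vanish.\<close>

lemma column_exchange_nsum:
  assumes le: "n' \<le> n" "k' \<le> k"
    and n': "n' = l' \<or> n' = Suc l'" and k': "k' = l' \<or> k' = Suc l'"
  shows "(\<integral>\<^sup>+r'. ennreal (upper_col t a b n k n' k' r r') * ennreal (cauchy_weight t (a * b) l' n' k' r') \<partial>count_space UNIV)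
       = (\<integral>\<^sup>+l. ennreal (cauchy_weight t (a * b) l n k r) * ennreal (lower_col t a b n k n' k' l l') \<partial>count_space UNIV)"
    (is "?L = ?R")
proof (cases "(r = n \<or> r = Suc n) \<and> (r = k \<or> r = Suc k)")
  case False
  have L: "upper_col t a b n k n' k' r r' = 0" for r' using False by (auto simp: upper_col_def)
  have R: "cauchy_weight t (a * b) l n k r = 0" for l using False by (auto simp: cauchy_weight_eq[OF ab_bounds(1,2)])
  show ?thesis unfolding L R by simp
next
  case True
  have "?L = (\<Sum>r'\<in>{l', Suc l', Suc (Suc l')}. ennreal (upper_col t a b n k n' k' r r') * ennreal (cauchy_weight t (a * b) l' n' k' r'))"
    by (rule nn_integral_count_space') (auto simp: cauchy_weight_eq[OF ab_bounds(1,2)])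
  also have "\<dots> = ennreal (\<Sum>r'\<in>{l', Suc l', Suc (Suc l')}. upper_col t a b n k n' k' r r' * cauchy_weight t (a * b) l' n' k' r')"
    by (subst sum_ennreal[symmetric]) (auto simp: upper_col_nonneg cauchy_weight_nonneg ennreal_mult)
  also have "(\<Sum>r'\<in>{l', Suc l', Suc (Suc l')}. upper_col t a b n k n' k' r r' * cauchy_weight t (a * b) l' n' k' r')
    = (\<Sum>l\<in>(if n = 0 then {0} else {n, n - 1}). cauchy_weight t (a * b) l n k r * lower_col t a b n k n' k' l l')"
    using column_exchange[OF ab_bounds(1,2) n' k', of r n k] True le by (cases "n = 0") (simp_all add: add.assoc)
  also have "ennreal \<dots> = (\<Sum>l\<in>(if n = 0 then {0} else {n, n - 1}). ennreal (cauchy_weight t (a * b) l n k r) * ennreal (lower_col t a b n k n' k' l l'))"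
    by (subst sum_ennreal[symmetric]) (auto simp: lower_col_nonneg cauchy_weight_nonneg ennreal_mult)
  also have "\<dots> = ?R"
    by (rule nn_integral_count_space'[symmetric]) (auto simp: lower_col_def split: if_splits)
  finally show ?thesis .
qed

text \<open>Only single rows interlace with the empty partition, so r is at most 1. For r = 1 the
  rows of all lengths give a geometric series in a * b.\<close>

lemma upper_sum_Nil: "upper_sum [] [] r = ennreal (cauchy_weight t (a * b) 0 0 0 r)"
proof -
  consider "r = 0" | "r = 1" | "2 \<le> r" by linarith
  thus ?thesis
  proof cases
    case 1
    have "interlaces [] []" by (simp add: interlaces_def)
    hence "hl_P1 t [] [] a * hl_Q1 t [] [] b = 1" by (simp add: hl_P1_def hl_Q1_def)
    thus ?thesis using 1 by (simp add: upper_sum_def partitions_of_length_0 nn_integral_count_space_finite cauchy_weight_eq[OF ab_bounds(1,2)])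
  next
    case 2
    have bij: "bij_betw (\<lambda>k. [Suc k]) UNIV (partitions_of_length 1)"
      by (rule bij_betw_byWitness[where f' = "\<lambda>x. hd x - 1"])
         (auto simp: partitions_of_length_def is_partition_def length_Suc_conv)
    have "hl_P1 t [Suc k] [] a * hl_Q1 t [Suc k] [] b = (1 - t) * (a * b) * (a * b) ^ k" for k
    proof -
      have "interlaces [] [Suc k]" by (simp add: interlaces_def nth_default_Cons)
      \<comment> \<open>The one part, of size k + 1, is the only size whose multiplicity grows, from
        0 to 1; it gives Q the factor 1 - t.\<close>
      moreover have "{i. Suc 0 \<le> i \<and> (if Suc k = i then 0 + 1 else 0) = Suc 0} = {Suc k}" by auto
      ultimately show ?thesis by (simp add: hl_P1_def hl_Q1_def power_mult_distrib cong: if_cong)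
    qed
    hence "upper_sum [] [] r = (\<integral>\<^sup>+k. ennreal ((1 - t) * (a * b) * (a * b) ^ k) \<partial>count_space UNIV)"
      unfolding upper_sum_def 2 by (subst nn_integral_bij_count_space[OF bij, symmetric]) simp
    also have "\<dots> = (\<Sum>k. ennreal ((1 - t) * (a * b) * (a * b) ^ k))"
      by (rule nn_integral_count_space_nat)
    also have "\<dots> = ennreal ((1 - t) * (a * b) * (1 / (1 - a * b)))"
      using t ab_bounds ab by (intro suminf_ennreal_eq sums_mult geometric_sums) auto
    finally show ?thesis using 2 by (simp add: cauchy_weight_eq[OF ab_bounds(1,2)] mult.commute)
  next
    case 3
    have *: "hl_P1 t \<tau> [] a * hl_Q1 t \<tau> [] b = 0" if "\<tau> \<in> partitions_of_length r" for \<tau>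
      using that 3 interlaces_length[of "[]" \<tau>]
      by (auto simp: partitions_of_length_def hl_P1_def hl_Q1_def is_partition_def)
    have "upper_sum [] [] r = (\<integral>\<^sup>+\<tau>. 0 \<partial>count_space (partitions_of_length r))"
      unfolding upper_sum_def by (intro nn_integral_cong) (auto dest!: *)
    thus ?thesis using 3 by (simp add: cauchy_weight_eq[OF ab_bounds(1,2)])
  qed
qed

lemma lower_sum_Nil: "lower_sum [] [] l = (if l = 0 then 1 else 0)"
proof (cases "l = 0")
  case True
  have "interlaces [] []" by (simp add: interlaces_def)
  hence "hl_P1 t [] [] a * hl_Q1 t [] [] b = 1" by (simp add: hl_P1_def hl_Q1_def)
  thus ?thesis using True by (simp add: lower_sum_def partitions_of_length_0 nn_integral_count_space_finite)
next
  case False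
  thus ?thesis by (subst lower_sum_eq_0) (auto simp: is_partition_def)
qed

lemma refined_skew_cauchy:
  assumes "is_partition \<mu>" "is_partition \<kappa>"
  shows "upper_sum \<mu> \<kappa> r = (\<integral>\<^sup>+l. ennreal (cauchy_weight t (a * b) l (length \<mu>) (length \<kappa>) r) * lower_sum \<mu> \<kappa> l \<partial>count_space UNIV)"
  using assms
proof (induction "sum_list \<mu> + sum_list \<kappa>" arbitrary: \<mu> \<kappa> r rule: less_induct)
  case less
  show ?case
  proof (cases "\<mu> = [] \<and> \<kappa> = []")
    case True
    have "(\<integral>\<^sup>+l. ennreal (cauchy_weight t (a * b) l 0 0 r) * lower_sum [] [] l \<partial>count_space UNIV)
        = (\<Sum>l\<in>{0}. ennreal (cauchy_weight t (a * b) l 0 0 r) * lower_sum [] [] l)"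
      by (rule nn_integral_count_space') (auto simp: lower_sum_Nil)
    thus ?thesis using True by (simp add: upper_sum_Nil lower_sum_Nil)
  next
    case False
    define \<rho> \<sigma> n k where defs: "\<rho> = dropcol \<mu>" "\<sigma> = dropcol \<kappa>" "n = length \<mu>" "k = length \<kappa>"
    have p: "is_partition \<rho>" "is_partition \<sigma>" and le: "length \<rho> \<le> n" "length \<sigma> \<le> k"
      using less.prems by (auto simp: defs is_partition_dropcol length_dropcol)
    have eq: "\<mu> = addcol n \<rho>" "\<kappa> = addcol k \<sigma>" using less.prems by (simp_all add: defs addcol_dropcol)
    \<comment> \<open>The removed columns have n + k cells together, so the total size drops even if
      one of the partitions is empty.\<close>
    have "0 < n + k" using False by (auto simp: defs)
    hence sm: "sum_list \<rho> + sum_list \<sigma> < sum_list \<mu> + sum_list \<kappa>" by (simp add: eq sum_list_addcol le)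
    let ?c = "\<lambda>l n k r. ennreal (cauchy_weight t (a * b) l n k r)"
    let ?n' = "length \<rho>" and ?k' = "length \<sigma>"
    let ?B = "\<lambda>r'. ennreal (upper_col t a b n k ?n' ?k' r r')"
    let ?A = "\<lambda>l l'. ennreal (lower_col t a b n k ?n' ?k' l l')"
    have "upper_sum \<mu> \<kappa> r = (\<integral>\<^sup>+r'. (\<integral>\<^sup>+l'. ?B r' * ?c l' ?n' ?k' r' * lower_sum \<rho> \<sigma> l' \<partial>count_space UNIV) \<partial>count_space UNIV)"
      unfolding eq upper_sum_addcol[OF p le] less.hyps[OF sm p]
      by (simp add: nn_integral_cmult mult.assoc)
    also have "\<dots> = (\<integral>\<^sup>+l'. (\<integral>\<^sup>+r'. ?B r' * ?c l' ?n' ?k' r' \<partial>count_space UNIV) * lower_sum \<rho> \<sigma> l' \<partial>count_space UNIV)"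
      by (subst nsum_swap) (simp add: nn_integral_multc)
    also have "\<dots> = (\<integral>\<^sup>+l'. (\<integral>\<^sup>+l. ?c l n k r * ?A l l' \<partial>count_space UNIV) * lower_sum \<rho> \<sigma> l' \<partial>count_space UNIV)"
    proof (intro nn_integral_cong)
      fix l'
      show "(\<integral>\<^sup>+r'. ?B r' * ?c l' ?n' ?k' r' \<partial>count_space UNIV) * lower_sum \<rho> \<sigma> l'
          = (\<integral>\<^sup>+l. ?c l n k r * ?A l l' \<partial>count_space UNIV) * lower_sum \<rho> \<sigma> l'"
      \<comment> \<open>The exchange relation covers only lengths allowed by interlacing; for all
        others \<open>lower_sum\<close> is 0.\<close>
      proof (cases "(?n' = l' \<or> ?n' = Suc l') \<and> (?k' = l' \<or> ?k' = Suc l')")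
        case True
        thus ?thesis using column_exchange_nsum[OF le] by simp
      next
        case False
        thus ?thesis using lower_sum_eq_0[OF p] by simp
      qed
    qed
    also have "\<dots> = (\<integral>\<^sup>+l'. (\<integral>\<^sup>+l. ?c l n k r * (?A l l' * lower_sum \<rho> \<sigma> l') \<partial>count_space UNIV) \<partial>count_space UNIV)"
      by (simp add: nn_integral_multc[symmetric] mult.assoc)
    also have "\<dots> = (\<integral>\<^sup>+l. (\<integral>\<^sup>+l'. ?c l n k r * (?A l l' * lower_sum \<rho> \<sigma> l') \<partial>count_space UNIV) \<partial>count_space UNIV)"
      by (rule nsum_swap)
    also have "\<dots> = (\<integral>\<^sup>+l. ?c l n k r * lower_sum \<mu> \<kappa> l \<partial>count_space UNIV)"
      by (simp add: nn_integral_cmult eq lower_sum_addcol[OF p le])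
    finally show ?thesis by (simp add: defs)
  qed
qed

end

section \<open>Moving a variable through the process\<close>

lemma nsum_lists_Suc:
  "(\<integral>\<^sup>+xs. f xs \<partial>count_space {xs. length xs = Suc m})
   = (\<integral>\<^sup>+x. (\<integral>\<^sup>+xs. f (x # xs) \<partial>count_space {xs. length xs = m}) \<partial>count_space UNIV)"
proof -
  have bij: "bij_betw ((#) x) {xs. length xs = m} {xs. length xs = Suc m \<and> hd xs = x}" for x :: 'a
    by (rule bij_betw_byWitness[where f' = tl]) (auto simp: length_Suc_conv)
  show ?thesis
    by (subst nsum_fibre[where g = hd]) (simp add: nn_integral_bij_count_space[OF bij, symmetric])
qed

text \<open>The transfer operator of Q(b). Fixing the length n of the inner partition keeps lengths
  visible when the operator is moved.\<close>

definition Q_op :: "real \<Rightarrow> real \<Rightarrow> nat \<Rightarrow> (nat list \<Rightarrow> ennreal) \<Rightarrow> nat list \<Rightarrow> ennreal" where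
  "Q_op t b n f \<kappa> = (\<integral>\<^sup>+\<mu>. ennreal (hl_Q1 t \<kappa> \<mu> b) * f \<mu> \<partial>count_space (partitions_of_length n))"

text \<open>Starting from the empty partition and with f the function Q in b_1, ..., b_N, this is
  the unnormalised probability that the column lengths are the given list. The index j is that of
  the next variable.\<close>

primrec P_chain_sum :: "real \<Rightarrow> (nat \<Rightarrow> real) \<Rightarrow> nat \<Rightarrow> nat list \<Rightarrow> (nat list \<Rightarrow> ennreal) \<Rightarrow> nat list \<Rightarrow> ennreal" where
  "P_chain_sum t a j [] f \<kappa> = f \<kappa>"
| "P_chain_sum t a j (r # rs) f \<kappa> =
     (\<integral>\<^sup>+\<tau>. ennreal (hl_P1 t \<tau> \<kappa> (a j)) * P_chain_sum t a (Suc j) rs f \<tau> \<partial>count_space (partitions_of_length r))"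

lemma P_chain_sum_Cons: "P_chain_sum t a j (r # rs) f =
    (\<lambda>\<kappa>. \<integral>\<^sup>+\<tau>. ennreal (hl_P1 t \<tau> \<kappa> (a j)) * P_chain_sum t a (Suc j) rs f \<tau> \<partial>count_space (partitions_of_length r))"
  by (rule ext) simp

text \<open>The refined identity summed against g, read as a commutation relation: going up by P and
  then down by Q is replaced by going down by Q and then up by P, at the cost of a weight in the
  lengths.\<close>

lemma (in hl_params) skew_cauchy_operator:
  assumes "\<kappa> \<in> partitions_of_length k"
  shows "(\<integral>\<^sup>+\<tau>. ennreal (hl_P1 t \<tau> \<kappa> a) * Q_op t b n g \<tau> \<partial>count_space (partitions_of_length r))
    = (\<integral>\<^sup>+l. ennreal (cauchy_weight t (a * b) l n k r) *
        Q_op t b l (\<lambda>\<nu>. \<integral>\<^sup>+\<mu>. ennreal (hl_P1 t \<mu> \<nu> a) * g \<mu> \<partial>count_space (partitions_of_length n)) \<kappa> \<partial>count_space UNIV)"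
proof -
  note nn = hl_P1_nonneg[OF t ab(1)] hl_Q1_nonneg[OF t ab(2)]
  have "(\<integral>\<^sup>+\<tau>. ennreal (hl_P1 t \<tau> \<kappa> a) * Q_op t b n g \<tau> \<partial>count_space (partitions_of_length r))
     = (\<integral>\<^sup>+\<tau>. (\<integral>\<^sup>+\<mu>. ennreal (hl_P1 t \<tau> \<kappa> a * hl_Q1 t \<tau> \<mu> b) * g \<mu> \<partial>count_space (partitions_of_length n)) \<partial>count_space (partitions_of_length r))"
    by (simp add: Q_op_def nn_integral_cmult[symmetric] ennreal_mult nn mult.assoc)
  also have "\<dots> = (\<integral>\<^sup>+\<mu>. upper_sum \<mu> \<kappa> r * g \<mu> \<partial>count_space (partitions_of_length n))"
    by (subst nsum_swap) (simp add: upper_sum_def nn_integral_multc)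
  also have "\<dots> = (\<integral>\<^sup>+\<mu>. (\<integral>\<^sup>+l. ennreal (cauchy_weight t (a * b) l n k r) * (lower_sum \<mu> \<kappa> l * g \<mu>) \<partial>count_space UNIV) \<partial>count_space (partitions_of_length n))"
    using assms
    by (intro nn_integral_cong) (auto simp: partitions_of_length_def refined_skew_cauchy nn_integral_multc[symmetric] mult.assoc)
  also have "\<dots> = (\<integral>\<^sup>+l. ennreal (cauchy_weight t (a * b) l n k r) * (\<integral>\<^sup>+\<mu>. lower_sum \<mu> \<kappa> l * g \<mu> \<partial>count_space (partitions_of_length n)) \<partial>count_space UNIV)"
    by (subst nsum_swap) (simp add: nn_integral_cmult)
  moreover have "(\<integral>\<^sup>+\<mu>. lower_sum \<mu> \<kappa> l * g \<mu> \<partial>count_space (partitions_of_length n)) =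
      Q_op t b l (\<lambda>\<nu>. \<integral>\<^sup>+\<mu>. ennreal (hl_P1 t \<mu> \<nu> a) * g \<mu> \<partial>count_space (partitions_of_length n)) \<kappa>" for l
  proof -
    have "(\<integral>\<^sup>+\<mu>. lower_sum \<mu> \<kappa> l * g \<mu> \<partial>count_space (partitions_of_length n)) =
      (\<integral>\<^sup>+\<mu>. (\<integral>\<^sup>+\<nu>. ennreal (hl_Q1 t \<kappa> \<nu> b) * (ennreal (hl_P1 t \<mu> \<nu> a) * g \<mu>) \<partial>count_space (partitions_of_length l)) \<partial>count_space (partitions_of_length n))"
      by (simp add: lower_sum_def nn_integral_multc[symmetric] nn_integral_cmult[symmetric] ennreal_mult nn mult_ac)
    also have "\<dots> = Q_op t b l (\<lambda>\<nu>. \<integral>\<^sup>+\<mu>. ennreal (hl_P1 t \<mu> \<nu> a) * g \<mu> \<partial>count_space (partitions_of_length n)) \<kappa>"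
      by (subst nsum_swap) (simp add: Q_op_def nn_integral_cmult)
    finally show ?thesis .
  qed
  ultimately show ?thesis by simp
qed

text \<open>The rows are read from left to right; \<open>k\<close> and \<open>l\<close> are the values of \<open>\<ell>\<close> preceding \<open>rs\<close> (upper row)
  and \<open>ns\<close> (lower row).\<close>

fun row_wt :: "(nat \<Rightarrow> nat \<Rightarrow> nat \<Rightarrow> nat \<Rightarrow> nat \<Rightarrow> real) \<Rightarrow> nat \<Rightarrow> nat \<Rightarrow> nat \<Rightarrow> nat list \<Rightarrow> nat list \<Rightarrow> real" where
  "row_wt w j k l [] [] = 1"
| "row_wt w j k l (r # rs) (n # ns) = w j l n k r * row_wt w (Suc j) r n rs ns"
| "row_wt w j k l _ _ = 0"

lemma row_nonneg:
  assumes "\<And>i l n k r. j \<le> i \<Longrightarrow> 0 \<le> w i l n k r"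
  shows "0 \<le> row_wt w j k l rs ns"
  using assms
proof (induction w j k l rs ns rule: row_wt.induct)
  case (2 w j k l r rs n ns)
  then show ?case by (auto intro!: mult_nonneg_nonneg)
qed auto

lemma row_scale:
  assumes "\<And>i l n k r. w' i l n k r = c i * w i l n k r"
  shows "row_wt w' j k l rs ns = (\<Prod>i<length rs. c (j + i)) * row_wt w j k l rs ns"
  using assms
proof (induction w' j k l rs ns rule: row_wt.induct)
  case (2 w' j k l r rs n ns)
  then show ?case by (simp add: prod.lessThan_Suc_shift del: prod.lessThan_Suc)
qed auto

lemma row_length: "length rs \<noteq> length ns \<Longrightarrow> row_wt w j k l rs ns = 0"
  by (induction w j k l rs ns rule: row_wt.induct) auto

lemma vertex_weight_nonneg:
  assumes "0 \<le> t" "t \<le> 1" "0 \<le> p" "p < 1"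
  shows "0 \<le> vertex_weight t p l n k r"
proof -
  have "t * p \<le> 1 * p" using assms by (intro mult_right_mono) auto
  thus ?thesis using assms by (auto simp: vertex_weight_def)
qed

abbreviation row_cauchy :: "real \<Rightarrow> (nat \<Rightarrow> real) \<Rightarrow> real \<Rightarrow> nat \<Rightarrow> nat \<Rightarrow> nat \<Rightarrow> nat list \<Rightarrow> nat list \<Rightarrow> real" where
  "row_cauchy t a b \<equiv> row_wt (\<lambda>i. cauchy_weight t (a i * b))"

text \<open>The Q step at the far end is carried through the chain to its start. Passing the P with
  variable a_j produces one vertex; \<open>ns\<close> are the lengths of the chain that remains,
  which form the row below \<open>rs\<close>.\<close>

lemma P_chain_sum_Q_op:
  assumes t: "0 \<le> t" "t \<le> 1" and b: "0 \<le> b" and a: "\<And>i. j \<le> i \<Longrightarrow> 0 \<le> a i \<and> a i * b < 1"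
    and "\<kappa> \<in> partitions_of_length k"
  shows "P_chain_sum t a j rs (\<lambda>\<tau>. \<integral>\<^sup>+l. Q_op t b l f \<tau> \<partial>count_space UNIV) \<kappa> =
    (\<integral>\<^sup>+l. (\<integral>\<^sup>+ns. ennreal (row_cauchy t a b j k l rs ns) * Q_op t b l (P_chain_sum t a j ns f) \<kappa>
        \<partial>count_space {ns. length ns = length rs}) \<partial>count_space UNIV)"
  using a \<open>\<kappa> \<in> partitions_of_length k\<close>
proof (induction rs arbitrary: j k \<kappa>)
  case Nil
  have "{ns. length ns = length []} = {[] :: nat list}" "P_chain_sum t a j [] f = f" by auto
  hence "(\<integral>\<^sup>+ns. ennreal (row_cauchy t a b j k l [] ns) * Q_op t b l (P_chain_sum t a j ns f) \<kappa>
        \<partial>count_space {ns. length ns = length []}) = Q_op t b l f \<kappa>" for l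
    by (simp add: nn_integral_count_space_finite[of "{[]}"] cong: if_cong)
  thus ?case by simp
next
  case (Cons r rs)
  interpret hl_params t "a j" b
    using t b Cons.prems(1)[of j] by unfold_locales auto
  let ?L = "count_space {ns :: nat list. length ns = length rs}"
  let ?c = "\<lambda>l' ns. ennreal (row_cauchy t a b (Suc j) r l' rs ns)"
  have nn: "0 \<le> row_cauchy t a b (Suc j) r l' rs ns" for l' ns
  proof (rule row_nonneg)
    fix i l n k r assume "Suc j \<le> i"
    then interpret i: hl_params t "a i" b using t b Cons.prems(1)[of i] by unfold_locales auto
    show "0 \<le> cauchy_weight t (a i * b) l n k r" by (rule i.cauchy_weight_nonneg)
  qed
  have e: "ennreal (row_cauchy t a b j k l (r # rs) (l' # ns)) = ennreal (cauchy_weight t (a j * b) l l' k r) * ?c l' ns" for l l' ns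
    by (simp add: ennreal_mult cauchy_weight_nonneg nn)
  have "P_chain_sum t a j (r # rs) (\<lambda>\<tau>. \<integral>\<^sup>+l. Q_op t b l f \<tau> \<partial>count_space UNIV) \<kappa> =
    (\<integral>\<^sup>+\<tau>. (\<integral>\<^sup>+l'. (\<integral>\<^sup>+ns. ennreal (hl_P1 t \<tau> \<kappa> (a j)) * (?c l' ns * Q_op t b l' (P_chain_sum t a (Suc j) ns f) \<tau>)
      \<partial>?L) \<partial>count_space UNIV) \<partial>count_space (partitions_of_length r))"
    using Cons.prems(1)
    by (simp add: nn_integral_cmult, intro nn_integral_cong, subst Cons.IH) auto
  also have "\<dots> = (\<integral>\<^sup>+l'. (\<integral>\<^sup>+ns. ?c l' ns * (\<integral>\<^sup>+\<tau>. ennreal (hl_P1 t \<tau> \<kappa> (a j)) * Q_op t b l' (P_chain_sum t a (Suc j) ns f) \<tau>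
       \<partial>count_space (partitions_of_length r)) \<partial>?L) \<partial>count_space UNIV)"
    by (subst nsum_swap, intro nn_integral_cong, subst nsum_swap)
       (simp add: nn_integral_cmult[symmetric] mult_ac)
  also have "\<dots> = (\<integral>\<^sup>+l'. (\<integral>\<^sup>+ns. (\<integral>\<^sup>+l. ?c l' ns * (ennreal (cauchy_weight t (a j * b) l l' k r) *
       Q_op t b l (P_chain_sum t a j (l' # ns) f) \<kappa>) \<partial>count_space UNIV) \<partial>?L) \<partial>count_space UNIV)"
    by (simp add: skew_cauchy_operator[OF Cons.prems(2)] nn_integral_cmult P_chain_sum_Cons)
  also have "\<dots> = (\<integral>\<^sup>+l'. (\<integral>\<^sup>+l. (\<integral>\<^sup>+ns. ennreal (row_cauchy t a b j k l (r # rs) (l' # ns)) *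
       Q_op t b l (P_chain_sum t a j (l' # ns) f) \<kappa> \<partial>?L) \<partial>count_space UNIV) \<partial>count_space UNIV)"
    unfolding e by (intro nn_integral_cong, subst nsum_swap) (simp only: mult_ac)
  also have "\<dots> = (\<integral>\<^sup>+l. (\<integral>\<^sup>+l'. (\<integral>\<^sup>+ns. ennreal (row_cauchy t a b j k l (r # rs) (l' # ns)) *
       Q_op t b l (P_chain_sum t a j (l' # ns) f) \<kappa> \<partial>?L) \<partial>count_space UNIV) \<partial>count_space UNIV)"
    by (rule nsum_swap)
  also have "\<dots> = (\<integral>\<^sup>+l. (\<integral>\<^sup>+ns. ennreal (row_cauchy t a b j k l (r # rs) ns) * Q_op t b l (P_chain_sum t a j ns f) \<kappa>
        \<partial>count_space {ns. length ns = length (r # rs)}) \<partial>count_space UNIV)"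
    by (simp only: nsum_lists_Suc list.size add_0_right add_Suc_right)
  finally show ?case .
qed

section \<open>Q in several variables and the two boundaries\<close>

lemma hl_Q_nonneg: 
  assumes "0 \<le> t" "t \<le> 1" "\<And>j. 1 \<le> j \<Longrightarrow> 0 \<le> b j"
  shows "0 \<le> hl_Q t b N \<kappa> \<mu>"
  using assms by (induction N arbitrary: \<kappa>) (auto intro!: sum_nonneg mult_nonneg_nonneg hl_Q1_nonneg)

lemma hl_Q_Suc:
  assumes "0 \<le> t" "t \<le> 1" "\<And>j. 1 \<le> j \<Longrightarrow> 0 \<le> b j"
  shows "ennreal (hl_Q t b (Suc N) \<kappa> \<mu>) =
    (\<integral>\<^sup>+l. Q_op t (b (Suc N)) l (\<lambda>\<nu>. ennreal (hl_Q t b N \<nu> \<mu>)) \<kappa> \<partial>count_space UNIV)"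
proof -
  have "ennreal (hl_Q t b (Suc N) \<kappa> \<mu>) =
      (\<Sum>\<nu> | is_partition \<nu> \<and> interlaces \<nu> \<kappa>. ennreal (hl_Q1 t \<kappa> \<nu> (b (Suc N))) * ennreal (hl_Q t b N \<nu> \<mu>))"
    using assms by (simp add: sum_ennreal[symmetric] hl_Q1_nonneg hl_Q_nonneg ennreal_mult)
  also have "\<dots> = (\<integral>\<^sup>+\<nu>. ennreal (hl_Q1 t \<kappa> \<nu> (b (Suc N))) * ennreal (hl_Q t b N \<nu> \<mu>) \<partial>count_space {\<nu>. is_partition \<nu>})"
    by (rule nn_integral_count_space'[symmetric]) (auto simp: finite_interlaces hl_Q1_def)
  also have "\<dots> = (\<integral>\<^sup>+l. Q_op t (b (Suc N)) l (\<lambda>\<nu>. ennreal (hl_Q t b N \<nu> \<mu>)) \<kappa> \<partial>count_space UNIV)"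
    unfolding Q_op_def partitions_of_length_def by (subst nsum_fibre[where g = length]) simp
  finally show ?thesis .
qed

lemma interlaces_Nil: 
  assumes "is_partition \<mu>"
  shows "interlaces \<mu> [] \<longleftrightarrow> \<mu> = []"
  using interlaces_length[of \<mu> "[]"] assms
  by (auto simp: interlaces_def is_partition_def)

lemma Nil_in_partitions_of_length: "[] \<in> partitions_of_length 0"
  by (simp add: partitions_of_length_0)

lemma hl_P1_Nil: "hl_P1 t [] [] a = 1" and hl_Q1_Nil: "hl_Q1 t [] [] b = 1"
  by (simp_all add: hl_P1_def hl_Q1_def interlaces_def)

text \<open>Only the empty partition lies below the empty one. In the vertex model this is the left
  boundary, with every left edge of the first column of vertices occupied.\<close>

lemma Q_op_Nil: "Q_op t b l g [] = (if l = 0 then g [] else 0)"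
proof (cases "l = 0")
  case True
  thus ?thesis by (simp add: Q_op_def partitions_of_length_0 nn_integral_count_space_finite hl_Q1_Nil)
next
  case False
  have "Q_op t b l g [] = (\<integral>\<^sup>+\<mu>. 0 \<partial>count_space (partitions_of_length l))"
    unfolding Q_op_def using False
    by (intro nn_integral_cong) (auto simp: hl_Q1_def partitions_of_length_def interlaces_Nil)
  thus ?thesis using False by simp
qed

text \<open>Without b variables Q is the indicator of the empty partition, and a chain of growing
  partitions that ends there is empty throughout. This is the empty bottom boundary, the zero
  row.\<close>

lemma P_chain_sum_delta:
  assumes "is_partition \<kappa>"
  shows "P_chain_sum t a j rs (\<lambda>\<tau>. if \<tau> = [] then 1 else 0) \<kappa> = (if \<kappa> = [] \<and> rs = replicate (length rs) 0 then 1 else 0)"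
  using assms
proof (induction rs arbitrary: j \<kappa>)
  case (Cons r rs)
  have "P_chain_sum t a j (r # rs) (\<lambda>\<tau>. if \<tau> = [] then 1 else 0) \<kappa>
     = (\<integral>\<^sup>+\<tau>. (if \<kappa> = [] \<and> r # rs = replicate (Suc (length rs)) 0 then 1 else 0) * indicator {[]} \<tau> \<partial>count_space (partitions_of_length r))"
    using Cons.prems interlaces_Nil[OF Cons.prems]
    unfolding P_chain_sum.simps
    by (intro nn_integral_cong) (auto simp: Cons.IH partitions_of_length_def hl_P1_Nil hl_P1_def[of _ "[]" \<kappa>] indicator_def)
  also have "\<dots> = (if \<kappa> = [] \<and> r # rs = replicate (Suc (length rs)) 0 then 1 else 0)"
    by (auto simp: nn_integral_cmult partitions_of_length_0 Nil_in_partitions_of_length)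
  finally show ?case by simp
qed simp

text \<open>Histories list the rows with the most recent one first, so the appended \<open>replicate M 0\<close> is row \<open>0\<close>.\<close>

primrec history_weight :: "real \<Rightarrow> (nat \<Rightarrow> real) \<Rightarrow> (nat \<Rightarrow> real) \<Rightarrow> nat \<Rightarrow> nat list list \<Rightarrow> real" where
  "history_weight t a b M [] = 1"
| "history_weight t a b M (rs # Rs) = row_wt (\<lambda>i. vertex_weight t (a i * b (Suc (length Rs)))) 1 0 0 rs (hd (Rs @ [replicate M 0])) * history_weight t a b M Rs"

abbreviation histories :: "nat \<Rightarrow> nat \<Rightarrow> nat list \<Rightarrow> nat list list set" where
  "histories M N rs \<equiv> {Rs. length Rs = N \<and> hd (Rs @ [replicate M 0]) = rs}"

section \<open>The law of the column lengths in the Hall--Littlewood process\<close>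

locale hl_process_params =
  fixes t :: real and a b :: "nat \<Rightarrow> real"
  assumes t: "0 \<le> t" "t \<le> 1" and a: "\<And>i. 1 \<le> i \<Longrightarrow> 0 \<le> a i" and b: "\<And>j. 1 \<le> j \<Longrightarrow> 0 \<le> b j"
    and ab: "\<And>i j. 1 \<le> i \<Longrightarrow> 1 \<le> j \<Longrightarrow> a i * b j < 1"
begin

lemma row_vertex_weight_nonneg:
  assumes "1 \<le> j" "1 \<le> y"
  shows "0 \<le> row_wt (\<lambda>i. vertex_weight t (a i * b y)) j k l rs ns"
  using t a b ab assms by (intro row_nonneg vertex_weight_nonneg) auto

lemma history_weight_nonneg: "0 \<le> history_weight t a b M Rs"
  by (induction Rs) (auto intro!: mult_nonneg_nonneg row_vertex_weight_nonneg simp del: row_wt.simps)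

definition cauchy_const :: "nat \<Rightarrow> nat \<Rightarrow> real" where
  "cauchy_const M N = (\<Prod>j=1..N. \<Prod>i=1..M. (1 - t * a i * b j) / (1 - a i * b j))"

lemma cauchy_const_pos: "0 < cauchy_const M N"
  unfolding cauchy_const_def
proof (intro prod_pos ballI)
  fix i j assume "i \<in> {1..M}" "j \<in> {1..N}"
  then interpret hl_params t "a i" "b j" using t a b ab by unfold_locales auto
  show "0 < (1 - t * a i * b j) / (1 - a i * b j)" using ab_bounds ab
    by (auto simp: mult.assoc)
qed

text \<open>The Cauchy factors of the vertices in row N + 1 are exactly the factors with j = N + 1
  of the normalising product.\<close>

lemma row_cauchy_eq:
  "length rs = M \<Longrightarrow> row_cauchy t a (b (Suc N)) 1 0 0 rs ns * cauchy_const M N = row_wt (\<lambda>i. vertex_weight t (a i * b (Suc N))) 1 0 0 rs ns * cauchy_const M (Suc N)"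
  by (subst row_scale[where c = "\<lambda>i. (1 - t * (a i * b (Suc N))) / (1 - a i * b (Suc N))"
        and w = "\<lambda>i. vertex_weight t (a i * b (Suc N))"])
     (simp_all add: cauchy_weight_def cauchy_const_def prod.atLeast1_atMost_eq mult.assoc)

text \<open>Induction on N: splitting off b_(N+1) and moving it through the chain puts one row on
  top of the history and adds one row of factors to the normalisation.\<close>

lemma P_chain_sum_hl_Q:
  assumes "length rs = M"
  shows "P_chain_sum t a 1 rs (\<lambda>\<tau>. ennreal (hl_Q t b N \<tau> [])) [] =
    ennreal (cauchy_const M N) * (\<integral>\<^sup>+Rs. ennreal (history_weight t a b M Rs) \<partial>count_space (histories M N rs))"
  using assms
proof (induction N arbitrary: rs)
  case 0
  have "(\<lambda>\<tau>. ennreal (hl_Q t b 0 \<tau> [])) = (\<lambda>\<tau>. if \<tau> = [] then 1 else 0)" by auto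
  moreover have "histories M 0 rs = (if rs = replicate M 0 then {[]} else {})" by auto
  ultimately show ?case using 0 
    by (simp add: P_chain_sum_delta is_partition_def nn_integral_count_space_finite cauchy_const_def del: P_chain_sum.simps)
next
  case (Suc N)
  let ?w = "\<lambda>ns. row_wt (\<lambda>i. vertex_weight t (a i * b (Suc N))) 1 0 0 rs ns"
  let ?h = "\<lambda>ns. \<integral>\<^sup>+Rs. ennreal (history_weight t a b M Rs) \<partial>count_space (histories M N ns)"
  have "P_chain_sum t a 1 rs (\<lambda>\<tau>. ennreal (hl_Q t b (Suc N) \<tau> [])) [] =
    (\<integral>\<^sup>+l. (\<integral>\<^sup>+ns. ennreal (row_cauchy t a (b (Suc N)) 1 0 l rs ns) *
       Q_op t (b (Suc N)) l (P_chain_sum t a 1 ns (\<lambda>\<tau>. ennreal (hl_Q t b N \<tau> []))) []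
        \<partial>count_space {ns. length ns = length rs}) \<partial>count_space UNIV)"
  proof -
    have "ennreal (hl_Q t b (Suc N) \<tau> []) =
        (\<integral>\<^sup>+l. Q_op t (b (Suc N)) l (\<lambda>\<nu>. ennreal (hl_Q t b N \<nu> [])) \<tau> \<partial>count_space UNIV)" for \<tau>
      by (rule hl_Q_Suc) (use t b in auto)
    thus ?thesis using t a b ab by (simp only:) (rule P_chain_sum_Q_op[OF _ _ _ _ Nil_in_partitions_of_length], auto)
  qed
  also have "\<dots> = (\<integral>\<^sup>+l. (\<integral>\<^sup>+ns. ennreal (row_cauchy t a (b (Suc N)) 1 0 0 rs ns) *
       P_chain_sum t a 1 ns (\<lambda>\<tau>. ennreal (hl_Q t b N \<tau> [])) []
        \<partial>count_space {ns. length ns = length rs}) * indicator {0::nat} l \<partial>count_space UNIV)"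
    by (intro nn_integral_cong) (auto simp: Q_op_Nil indicator_def)
  also have "\<dots> = (\<integral>\<^sup>+ns. ennreal (row_cauchy t a (b (Suc N)) 1 0 0 rs ns) *
       P_chain_sum t a 1 ns (\<lambda>\<tau>. ennreal (hl_Q t b N \<tau> [])) [] \<partial>count_space {ns. length ns = length rs})"
    by (simp add: nn_integral_cmult)
  also have "\<dots> = (\<integral>\<^sup>+ns. ennreal (?w ns) * ennreal (cauchy_const M (Suc N)) * ?h ns \<partial>count_space {ns. length ns = length rs})"
  proof (intro nn_integral_cong)
    fix ns :: "nat list" assume "ns \<in> space (count_space {ns. length ns = length rs})"
    hence col_len: "length ns = M" using Suc.prems by simp
    have "ennreal (row_cauchy t a (b (Suc N)) 1 0 0 rs ns) * P_chain_sum t a 1 ns (\<lambda>\<tau>. ennreal (hl_Q t b N \<tau> [])) []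
        = ennreal (row_cauchy t a (b (Suc N)) 1 0 0 rs ns * cauchy_const M N) * ?h ns"
      unfolding Suc.IH[OF col_len] using cauchy_const_pos[of M N] by (simp add: ennreal_mult'' mult.assoc)
    also have "\<dots> = ennreal (?w ns) * ennreal (cauchy_const M (Suc N)) * ?h ns"
      unfolding row_cauchy_eq[OF Suc.prems] using cauchy_const_pos[of M "Suc N"] by (simp add: ennreal_mult'')
    finally show "ennreal (row_cauchy t a (b (Suc N)) 1 0 0 rs ns) * P_chain_sum t a 1 ns (\<lambda>\<tau>. ennreal (hl_Q t b N \<tau> [])) []
      = ennreal (?w ns) * ennreal (cauchy_const M (Suc N)) * ?h ns" .
  qed
  also have "\<dots> = ennreal (cauchy_const M (Suc N)) * (\<integral>\<^sup>+ns. ennreal (?w ns) * ?h ns \<partial>count_space {ns. length ns = length rs})"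
    by (simp add: nn_integral_cmult[symmetric] mult_ac)
  also have "(\<integral>\<^sup>+ns. ennreal (?w ns) * ?h ns \<partial>count_space {ns. length ns = length rs}) = (\<integral>\<^sup>+ns. ennreal (?w ns) * ?h ns \<partial>count_space UNIV)"
    by (rule nn_integral_count_space_eq) (simp_all add: row_length)
  also have "\<dots> = (\<integral>\<^sup>+ns. (\<integral>\<^sup>+Rs. ennreal (history_weight t a b M (rs # Rs)) \<partial>count_space (histories M N ns)) \<partial>count_space UNIV)"
    by (intro nn_integral_cong, subst nn_integral_cmult[symmetric], simp, intro nn_integral_cong)
       (auto simp: ennreal_mult row_vertex_weight_nonneg history_weight_nonneg)
  also have "\<dots> = (\<integral>\<^sup>+Rs. ennreal (history_weight t a b M (rs # Rs)) \<partial>count_space {Rs. length Rs = N})"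
    by (subst nsum_fibre[where g = "\<lambda>Rs. hd (Rs @ [replicate M 0])"]) simp
  also have "\<dots> = (\<integral>\<^sup>+Rs. ennreal (history_weight t a b M Rs) \<partial>count_space (histories M (Suc N) rs))"
    by (rule nn_integral_bij_count_space, rule bij_betw_byWitness[where f' = tl])
       (auto simp: length_Suc_conv)
  finally show ?case .
qed

primrec P_chain :: "nat \<Rightarrow> nat list \<Rightarrow> nat list list \<Rightarrow> real" where
  "P_chain j \<kappa> [] = 1"
| "P_chain j \<kappa> (\<tau> # \<Lambda>) = hl_P1 t \<tau> \<kappa> (a j) * P_chain (Suc j) \<tau> \<Lambda>"

lemma P_chain_nonneg: "1 \<le> j \<Longrightarrow> 0 \<le> P_chain j \<kappa> \<Lambda>"
  using t a by (induction \<Lambda> arbitrary: j \<kappa>) (auto intro!: mult_nonneg_nonneg hl_P1_nonneg)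

lemma P_chain_eq: "P_chain j \<kappa> \<Lambda> = (\<Prod>i<length \<Lambda>. hl_P1 t (\<Lambda> ! i) ((\<kappa> # \<Lambda>) ! i) (a (j + i)))"
  by (induction \<Lambda> arbitrary: j \<kappa>) (simp_all add: prod.lessThan_Suc_shift del: prod.lessThan_Suc)

lemma P_chain_sum_eq:
  assumes "1 \<le> j"
  shows "P_chain_sum t a j rs f \<kappa> = (\<integral>\<^sup>+\<Lambda>. ennreal (P_chain j \<kappa> \<Lambda>) * f (last (\<kappa> # \<Lambda>))
      \<partial>count_space {\<Lambda>. (\<forall>\<kappa>\<in>set \<Lambda>. is_partition \<kappa>) \<and> map length \<Lambda> = rs})"
  using assms
proof (induction rs arbitrary: j \<kappa>)
  case Nil
  have *: "{\<Lambda>. (\<forall>\<kappa>\<in>set \<Lambda>. is_partition \<kappa>) \<and> map length \<Lambda> = []} = {[]}" by auto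
  show ?case unfolding * by (subst nn_integral_count_space_finite) auto
next
  case (Cons r rs)
  let ?S = "\<lambda>rs. {\<Lambda>. (\<forall>\<kappa>\<in>set \<Lambda>. is_partition \<kappa>) \<and> map length \<Lambda> = rs}"
  let ?F = "\<lambda>j \<kappa> \<Lambda>. ennreal (P_chain j \<kappa> \<Lambda>) * f (last (\<kappa> # \<Lambda>))"
  have eq: "(\<integral>\<^sup>+\<Lambda>. ?F j \<kappa> \<Lambda> \<partial>count_space {\<Lambda> \<in> ?S (r # rs). hd \<Lambda> = \<tau>}) =
     (\<integral>\<^sup>+\<Lambda>. ?F j \<kappa> (\<tau> # \<Lambda>) \<partial>count_space (?S rs)) * indicator (partitions_of_length r) \<tau>" for \<tau>
  proof (cases "\<tau> \<in> partitions_of_length r")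
    case True
    have "bij_betw ((#) \<tau>) (?S rs) {\<Lambda> \<in> ?S (r # rs). hd \<Lambda> = \<tau>}"
    proof (rule bij_betw_byWitness[where f' = tl])
      show "\<forall>\<Lambda>\<in>?S rs. tl (\<tau> # \<Lambda>) = \<Lambda>" by simp
      show "\<forall>\<Lambda>\<in>{\<Lambda> \<in> ?S (r # rs). hd \<Lambda> = \<tau>}. \<tau> # tl \<Lambda> = \<Lambda>" by (auto simp: map_eq_Cons_conv)
      show "(#) \<tau> ` ?S rs \<subseteq> {\<Lambda> \<in> ?S (r # rs). hd \<Lambda> = \<tau>}" using True by (auto simp: partitions_of_length_def)
      show "tl ` {\<Lambda> \<in> ?S (r # rs). hd \<Lambda> = \<tau>} \<subseteq> ?S rs" by (auto simp: map_eq_Cons_conv)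
    qed
    thus ?thesis using True by (subst nn_integral_bij_count_space[symmetric]) auto
  next
    case False
    hence "{\<Lambda> \<in> ?S (r # rs). hd \<Lambda> = \<tau>} = {}" by (auto simp: partitions_of_length_def)
    thus ?thesis using False by (simp add: nn_integral_empty)
  qed
  have "(\<integral>\<^sup>+\<Lambda>. ?F j \<kappa> \<Lambda> \<partial>count_space (?S (r # rs)))
     = (\<integral>\<^sup>+\<tau>. (\<integral>\<^sup>+\<Lambda>. ?F j \<kappa> (\<tau> # \<Lambda>) \<partial>count_space (?S rs)) \<partial>count_space (partitions_of_length r))"
    by (subst nsum_fibre[where g = hd], subst eq, subst (2) nn_integral_count_space_indicator) auto
  also have "\<dots> = P_chain_sum t a j (r # rs) f \<kappa>"
    using Cons.prems t a
    by (simp add: Cons.IH, intro nn_integral_cong, subst nn_integral_cmult[symmetric])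
       (auto intro!: nn_integral_cong simp: ennreal_mult hl_P1_nonneg P_chain_nonneg mult.assoc)
  finally show ?case by simp
qed

text \<open>A step that is not even a containment is not interlacing, so its P factor is 0. Hence
  sums over all lists of partitions agree with sums over nested ones.\<close>

lemma P_chain_eq_0:
  assumes "length \<Lambda> = M" "\<forall>\<kappa>\<in>set \<Lambda>. is_partition \<kappa>" "\<Lambda> \<notin> partition_seqs M"
  shows "P_chain 1 [] \<Lambda> = 0"
proof -
  obtain i where i: "1 \<le> i" "i < M" "\<not> contained (hl_nth \<Lambda> i) (hl_nth \<Lambda> (i + 1))"
    using assms by (auto simp: partition_seqs_def)
  hence "hl_P1 t (\<Lambda> ! i) (([] # \<Lambda>) ! i) (a (1 + i)) = 0"
    by (auto simp: hl_P1_def hl_nth_def dest: interlaces_imp_contained)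
  thus ?thesis unfolding P_chain_eq using i assms by (intro prod_zero bexI[of _ i]) auto
qed

lemma hl_prob_eq:
  assumes "length \<Lambda> = M"
  shows "hl_prob t a b M N \<Lambda> = P_chain 1 [] \<Lambda> * hl_Q t b N (last ([] # \<Lambda>)) [] / cauchy_const M N"
proof -
  have "hl_nth \<Lambda> M = last ([] # \<Lambda>)"
    using assms by (simp add: hl_nth_def last_conv_nth[of "[] # \<Lambda>"] del: last.simps)
  moreover have "(\<Prod>i=1..M. hl_P1 t (hl_nth \<Lambda> i) (hl_nth \<Lambda> (i - 1)) (a i)) = P_chain 1 [] \<Lambda>"
    unfolding P_chain_eq using assms by (simp add: prod.atLeast1_atMost_eq hl_nth_def)
  ultimately show ?thesis by (simp add: hl_prob_def cauchy_const_def)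
qed

lemma emeasure_hl_process:
  assumes "length rs = M"
  shows "emeasure (hl_process t a b M N) {\<Lambda> \<in> partition_seqs M. map length \<Lambda> = rs} =
    (\<integral>\<^sup>+Rs. ennreal (history_weight t a b M Rs) \<partial>count_space (histories M N rs))"
proof -
  let ?S = "{\<Lambda>. (\<forall>\<kappa>\<in>set \<Lambda>. is_partition \<kappa>) \<and> map length \<Lambda> = rs}"
  let ?T = "{\<Lambda> \<in> partition_seqs M. map length \<Lambda> = rs}"
  let ?G = "\<lambda>\<Lambda>. ennreal (P_chain 1 [] \<Lambda>) * ennreal (hl_Q t b N (last ([] # \<Lambda>)) [])"
  have "emeasure (hl_process t a b M N) ?T = (\<integral>\<^sup>+\<Lambda>. ennreal (hl_prob t a b M N \<Lambda>) * indicator ?T \<Lambda> \<partial>count_space (partition_seqs M))"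
    unfolding hl_process_def point_measure_def by (subst emeasure_density) auto
  also have "\<dots> = (\<integral>\<^sup>+\<Lambda>. ennreal (hl_prob t a b M N \<Lambda>) \<partial>count_space ?T)"
    by (subst (1 2) nn_integral_count_space_indicator) (auto intro!: nn_integral_cong simp: indicator_def)
  also have "\<dots> = (\<integral>\<^sup>+\<Lambda>. ennreal (1 / cauchy_const M N) * ?G \<Lambda> \<partial>count_space ?T)"
  proof (intro nn_integral_cong)
    fix \<Lambda> assume "\<Lambda> \<in> space (count_space ?T)"
    hence "length \<Lambda> = M" by (simp add: partition_seqs_def)
    hence "hl_prob t a b M N \<Lambda> = 1 / cauchy_const M N * (P_chain 1 [] \<Lambda> * hl_Q t b N (last ([] # \<Lambda>)) [])"
      by (subst hl_prob_eq) auto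
    thus "ennreal (hl_prob t a b M N \<Lambda>) = ennreal (1 / cauchy_const M N) * ?G \<Lambda>"
      using cauchy_const_pos[of M N] P_chain_nonneg[of 1] hl_Q_nonneg[OF t b]
      by (simp only: ennreal_mult'' ennreal_mult' mult_nonneg_nonneg le_refl)
  qed
  also have "\<dots> = ennreal (1 / cauchy_const M N) * (\<integral>\<^sup>+\<Lambda>. ?G \<Lambda> \<partial>count_space ?T)"
    by (simp add: nn_integral_cmult)
  also have "(\<integral>\<^sup>+\<Lambda>. ?G \<Lambda> \<partial>count_space ?T) = (\<integral>\<^sup>+\<Lambda>. ?G \<Lambda> \<partial>count_space ?S)"
  proof -
    have "?T \<subseteq> ?S" by (auto simp: partition_seqs_def)
    moreover have "?G \<Lambda> = 0" if "\<Lambda> \<in> ?S - ?T" for \<Lambda>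
      using that assms P_chain_eq_0[of \<Lambda> M] by auto
    ultimately show ?thesis by (intro nn_integral_count_space_eq) blast+
  qed
  also have "\<dots> = P_chain_sum t a 1 rs (\<lambda>\<tau>. ennreal (hl_Q t b N \<tau> [])) []"
    by (subst P_chain_sum_eq) simp_all
  also have "\<dots> = ennreal (cauchy_const M N) * (\<integral>\<^sup>+Rs. ennreal (history_weight t a b M Rs) \<partial>count_space (histories M N rs))"
    by (rule P_chain_sum_hl_Q[OF assms])
  finally show ?thesis using cauchy_const_pos[of M N]
    by (simp add: mult.assoc[symmetric] ennreal_mult[symmetric])
qed

end

section \<open>The six vertex model\<close>

text \<open>An occupied horizontal edge keeps the length unchanged from below to above, an occupied
  vertical edge raises it by one from left to right. Multiplying numerator and denominator of each
  probability by Q * p turns it into the vertex weight.\<close>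

lemma sixv_weight_eq_vertex_weight:
  assumes Q: "0 < Q" "Q < 1" and z: "1 / sqrt Q < z" and p: "p * (sqrt Q * z) = 1"
    and "n = l \<or> n = Suc l" "k = l \<or> k = Suc l" "r = n \<or> r = Suc n" "r = k \<or> r = Suc k"
  shows "sixv_weight Q z (k = l, n \<noteq> l) (r = n, r \<noteq> k) = vertex_weight Q p l n k r"
proof -
  define s where "s = sqrt Q"
  have s: "0 < s" "s < 1" "Q = s * s" using Q by (auto simp: s_def)
  have "1 / s < z" "p * (s * z) = 1" using z p by (simp_all add: s_def)
  hence "1 < z * s" and p': "p = 1 / (s * z)"
    using s(1) by (simp_all add: pos_divide_less_eq) (auto simp: eq_divide_eq)
  moreover have "s * s < 1 * 1" using s by (intro mult_strict_mono) auto
  \<comment> \<open>These bounds keep both denominators, 1 - z / sqrt Q and 1 - Q * p, away from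
    0.\<close>
  ultimately have sz: "1 < s * z" "s * s < s * z" by (auto simp: mult.commute)
  hence zs: "0 < z" "s < z" using s by (auto simp: zero_less_mult_iff)
  have 1: "(1 / Q - z / sqrt Q) / (1 - z / sqrt Q) = (1 - p) / (1 - Q * p)"
    and 2: "(1 - 1 / Q) / (1 - z / sqrt Q) = p * (1 - Q) / (1 - Q * p)"
    and 3: "(1 - sqrt Q * z) / (1 - z / sqrt Q) = Q * (1 - p) / (1 - Q * p)"
    and 4: "((Q - 1) * z / sqrt Q) / (1 - z / sqrt Q) = (1 - Q) / (1 - Q * p)"
    unfolding p' s_def[symmetric] s(3) using s zs by (simp_all add: field_simps)
  from assms(5-) show ?thesis
    by (auto simp: vertex_weight_def 1 2 3 4[unfolded divide_divide_eq_left])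
qed

definition col_len :: "((nat \<times> nat) \<times> (bool \<times> bool) \<Rightarrow> bool \<times> bool) \<Rightarrow> nat \<Rightarrow> nat \<Rightarrow> nat" where
  "col_len \<omega> x y = y - sixv_height \<omega> (Suc x) y"

text \<open>Arrow conservation fails on a null set of sample points, because a sample point carries arbitrary
  outputs.\<close>

definition conserving :: "((nat \<times> nat) \<times> (bool \<times> bool) \<Rightarrow> bool \<times> bool) \<Rightarrow> bool" where
  "conserving \<omega> \<longleftrightarrow> (\<forall>v\<in>sixv_index.
     (of_bool (fst (\<omega> v)) + of_bool (snd (\<omega> v)) :: nat) = of_bool (fst (snd v)) + of_bool (snd (snd v)))"

section \<open>Column lengths read off from a configuration\<close>

lemma sixv_height_0: "sixv_height \<omega> x 0 = 0"
  by (simp add: sixv_height_def)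

lemma sixv_height_Suc:
  "sixv_height \<omega> x (Suc y) = sixv_height \<omega> x y + of_bool (left_edge \<omega> x (Suc y))"
proof -
  have "{y' \<in> {1..Suc y}. left_edge \<omega> x y'} = {y' \<in> {1..y}. left_edge \<omega> x y'} \<union> (if left_edge \<omega> x (Suc y) then {Suc y} else {})"
    by (auto simp: le_Suc_eq)
  thus ?thesis by (simp add: sixv_height_def)
qed

lemma sixv_height_le: "sixv_height \<omega> x y \<le> y"
  by (induction y) (auto simp: sixv_height_0 sixv_height_Suc)

lemma col_len_0: "col_len \<omega> x 0 = 0"
  by (simp add: col_len_def)

lemma col_len_Suc: "col_len \<omega> x (Suc y) = col_len \<omega> x y + of_bool (\<not> left_edge \<omega> (Suc x) (Suc y))"
  using sixv_height_le[of \<omega> "Suc x" y] by (auto simp: col_len_def sixv_height_Suc)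

lemma col_len_0_left: "col_len \<omega> 0 y = 0"
  by (induction y) (simp_all add: col_len_0 col_len_Suc left_edge.simps)

text \<open>Conservation summed up a column of vertices: the arrows that enter from the left and do
  not leave to the right exit through the top, since the bottom is empty.\<close>

lemma col_len_Suc_left:
  assumes "conserving \<omega>"
  shows "col_len \<omega> (Suc x) y = col_len \<omega> x y + of_bool (bottom_edge \<omega> (Suc x) (Suc y))"
proof (induction y)
  case 0
  show ?case by (simp add: col_len_0 bottom_edge.simps)
next
  case (Suc y)
  let ?i = "(left_edge \<omega> (Suc x) (Suc y), bottom_edge \<omega> (Suc x) (Suc y))"
  have "left_edge \<omega> (Suc (Suc x)) (Suc y) = fst (\<omega> ((Suc x, Suc y), ?i))"
    by (subst left_edge.simps) simp
  moreover have "bottom_edge \<omega> (Suc x) (Suc (Suc y)) = snd (\<omega> ((Suc x, Suc y), ?i))"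
    by (subst bottom_edge.simps) simp
  moreover have idx: "((Suc x, Suc y), ?i) \<in> sixv_index" by (simp add: sixv_index_def)
  ultimately have "(of_bool (left_edge \<omega> (Suc (Suc x)) (Suc y)) + of_bool (bottom_edge \<omega> (Suc x) (Suc (Suc y))) :: nat)
      = of_bool (left_edge \<omega> (Suc x) (Suc y)) + of_bool (bottom_edge \<omega> (Suc x) (Suc y))"
    using bspec[OF assms[unfolded conserving_def] idx] by (simp only: fst_conv snd_conv)
  thus ?case using Suc
    by (cases "left_edge \<omega> (Suc (Suc x)) (Suc y)"; cases "left_edge \<omega> (Suc x) (Suc y)") (simp_all add: col_len_Suc)
qed

text \<open>Recovers the edges of the vertex (x + 1, y + 1) from the values of f at the four points
  around it; \<open>out_edges\<close> does the same for its right and top edges.\<close>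

definition in_edges :: "(nat \<Rightarrow> nat \<Rightarrow> nat) \<Rightarrow> nat \<Rightarrow> nat \<Rightarrow> bool \<times> bool" where
  "in_edges f x y = (f x (Suc y) = f x y, f (Suc x) y \<noteq> f x y)"

definition out_edges :: "(nat \<Rightarrow> nat \<Rightarrow> nat) \<Rightarrow> nat \<Rightarrow> nat \<Rightarrow> bool \<times> bool" where
  "out_edges f x y = (f (Suc x) (Suc y) = f (Suc x) y, f (Suc x) (Suc y) \<noteq> f x (Suc y))"

definition steps_ok :: "(nat \<Rightarrow> nat \<Rightarrow> nat) \<Rightarrow> nat \<Rightarrow> nat \<Rightarrow> bool" where
  "steps_ok f x y \<longleftrightarrow> (f (Suc x) y = f x y \<or> f (Suc x) y = Suc (f x y)) \<and>
     (f x (Suc y) = f x y \<or> f x (Suc y) = Suc (f x y)) \<and>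
     (f (Suc x) (Suc y) = f (Suc x) y \<or> f (Suc x) (Suc y) = Suc (f (Suc x) y)) \<and>
     (f (Suc x) (Suc y) = f x (Suc y) \<or> f (Suc x) (Suc y) = Suc (f x (Suc y)))"

lemma vertex_weight_eq_0: "\<not> steps_ok f x y \<Longrightarrow> vertex_weight t p (f x y) (f (Suc x) y) (f x (Suc y)) (f (Suc x) (Suc y)) = 0"
  by (auto simp: steps_ok_def vertex_weight_def)

lemma in_edges_col_len: 
  assumes "conserving \<omega>"
  shows "in_edges (col_len \<omega>) x y = (left_edge \<omega> (Suc x) (Suc y), bottom_edge \<omega> (Suc x) (Suc y))"
  by (auto simp: in_edges_def col_len_Suc col_len_Suc_left[OF assms])

lemma out_edges_col_len: 
  assumes "conserving \<omega>"
  shows "out_edges (col_len \<omega>) x y = \<omega> ((Suc x, Suc y), in_edges (col_len \<omega>) x y)"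
proof -
  have "out_edges (col_len \<omega>) x y = (left_edge \<omega> (Suc (Suc x)) (Suc y), bottom_edge \<omega> (Suc x) (Suc (Suc y)))"
  proof -
    have "col_len \<omega> (Suc x) (Suc y) = col_len \<omega> (Suc x) y \<longleftrightarrow> left_edge \<omega> (Suc (Suc x)) (Suc y)"
      by (simp add: col_len_Suc)
    moreover have "col_len \<omega> (Suc x) (Suc y) = col_len \<omega> x (Suc y) \<longleftrightarrow> \<not> bottom_edge \<omega> (Suc x) (Suc (Suc y))"
      by (simp add: col_len_Suc_left[OF assms])
    ultimately show ?thesis by (simp add: out_edges_def)
  qed
  also have "\<dots> = \<omega> ((Suc x, Suc y), in_edges (col_len \<omega>) x y)"
    unfolding in_edges_col_len[OF assms] by (subst left_edge.simps, subst bottom_edge.simps) simp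
  finally show ?thesis .
qed

lemma steps_ok_col_len:
  assumes "conserving \<omega>"
  shows "steps_ok (col_len \<omega>) x y"
proof -
  have "col_len \<omega> x (Suc y) = col_len \<omega> x y \<or> col_len \<omega> x (Suc y) = Suc (col_len \<omega> x y)" for x y
    by (simp add: col_len_Suc)
  moreover have "col_len \<omega> (Suc x) y = col_len \<omega> x y \<or> col_len \<omega> (Suc x) y = Suc (col_len \<omega> x y)" for x y
    by (simp add: col_len_Suc_left[OF assms])
  ultimately show ?thesis by (simp add: steps_ok_def)
qed

text \<open>An event about dependent quantities becomes one about fixed coordinates of \<omega>: if
  the configuration follows f, each vertex consults the single entry whose inputs f
  predicts.\<close>

lemma col_len_eq_iff:
  assumes c: "conserving \<omega>" and f0: "\<And>x. x \<le> M \<Longrightarrow> f x 0 = 0" "\<And>y. y \<le> N \<Longrightarrow> f 0 y = 0"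
    and ok: "\<And>x y. x < M \<Longrightarrow> y < N \<Longrightarrow> steps_ok f x y"
  shows "(\<forall>x\<le>M. \<forall>y\<le>N. col_len \<omega> x y = f x y) \<longleftrightarrow>
    (\<forall>x<M. \<forall>y<N. \<omega> ((Suc x, Suc y), in_edges f x y) = out_edges f x y)"
proof
  assume *: "\<forall>x\<le>M. \<forall>y\<le>N. col_len \<omega> x y = f x y"
  show "\<forall>x<M. \<forall>y<N. \<omega> ((Suc x, Suc y), in_edges f x y) = out_edges f x y"
  proof (intro allI impI)
    fix x y assume "x < M" "y < N"
    hence "in_edges f x y = in_edges (col_len \<omega>) x y" "out_edges f x y = out_edges (col_len \<omega>) x y"
      using * by (simp_all add: in_edges_def out_edges_def)
    thus "\<omega> ((Suc x, Suc y), in_edges f x y) = out_edges f x y" using out_edges_col_len[OF c, of x y] by simp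
  qed
next
  assume *: "\<forall>x<M. \<forall>y<N. \<omega> ((Suc x, Suc y), in_edges f x y) = out_edges f x y"
  have "col_len \<omega> x y = f x y" if "x \<le> M" "y \<le> N" for x y
    using that
  proof (induction y arbitrary: x)
    case 0
    thus ?case by (simp add: col_len_0 f0)
  next
    case (Suc y)
    show ?case using Suc.prems(1)
    proof (induction x)
      case 0
      thus ?case using Suc.prems by (simp add: col_len_0_left f0)
    next
      case (Suc x)
      have eq: "col_len \<omega> x y = f x y" "col_len \<omega> (Suc x) y = f (Suc x) y" "col_len \<omega> x (Suc y) = f x (Suc y)"
        using Suc.IH Suc.prems \<open>Suc y \<le> N\<close> \<open>\<And>x. \<lbrakk>x \<le> M; y \<le> N\<rbrakk> \<Longrightarrow> col_len \<omega> x y = f x y\<close> by auto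
      hence "in_edges (col_len \<omega>) x y = in_edges f x y" by (simp add: in_edges_def)
      hence "out_edges (col_len \<omega>) x y = out_edges f x y"
        using * Suc.prems \<open>Suc y \<le> N\<close> by (simp add: out_edges_col_len[OF c])
      \<comment> \<open>Outgoing edges only tell whether the fourth corner equals its neighbours.
        Since steps are 0 or 1 on both sides, this determines its value.\<close>
      thus ?case using eq ok[of x y] steps_ok_col_len[OF c, of x y] Suc.prems \<open>Suc y \<le> N\<close>
        by (auto simp: out_edges_def steps_ok_def)
    qed
  qed
  thus "\<forall>x\<le>M. \<forall>y\<le>N. col_len \<omega> x y = f x y" by blast
qed

section \<open>Probabilities of prescribed configurations\<close>

locale sixv_params =
  fixes Q :: real and \<xi> u :: "nat \<Rightarrow> real"
  assumes Q: "0 < Q" "Q < 1" and xu: "\<And>x y. 1 \<le> x \<Longrightarrow> 1 \<le> y \<Longrightarrow> 1 / sqrt Q < \<xi> x * u y"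
begin

abbreviation P where "P \<equiv> sixv_measure Q \<xi> u"

lemma AE_conserving: "AE \<omega> in P. conserving \<omega>"
  unfolding conserving_def
proof (rule AE_ball_countable')
  show "countable sixv_index" unfolding sixv_index_def by auto
  fix v assume v: "v \<in> sixv_index"
  obtain x y i where xyi: "v = ((x, y), i)" by (metis prod.exhaust)
  have xy: "1 \<le> x" "1 \<le> y" using v by (auto simp: xyi sixv_index_def)
  have "AE out in measure_pmf (sixv_pmf Q (\<xi> x * u y) i).
      (of_bool (fst out) + of_bool (snd out) :: nat) = of_bool (fst i) + of_bool (snd i)"
  proof (subst AE_measure_pmf_iff, safe)
    fix o1 o2 assume "(o1, o2) \<in> set_pmf (sixv_pmf Q (\<xi> x * u y) i)"
    hence "sixv_weight Q (\<xi> x * u y) i (o1, o2) \<noteq> 0"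
      using pmf_sixv_pmf[OF Q xu[OF xy], of i "(o1, o2)"] by (simp add: set_pmf_iff)
    thus "(of_bool (fst (o1, o2)) + of_bool (snd (o1, o2)) :: nat) = of_bool (fst i) + of_bool (snd i)"
      by (cases i; cases "fst i"; cases "snd i") (auto split: if_splits)
  qed
  hence "AE out in (case v of ((x, y), i) \<Rightarrow> measure_pmf (sixv_pmf Q (\<xi> x * u y) i)).
      (of_bool (fst out) + of_bool (snd out) :: nat) = of_bool (fst i) + of_bool (snd i)"
    unfolding xyi prod.case .
  hence "AE \<omega> in P. (of_bool (fst (\<omega> v)) + of_bool (snd (\<omega> v)) :: nat) = of_bool (fst i) + of_bool (snd i)"
    unfolding sixv_measure_def
    by (intro AE_PiM_component[OF _ v]) (auto simp: prob_space_measure_pmf split: prod.splits)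
  thus "AE \<omega> in P. (of_bool (fst (\<omega> v)) + of_bool (snd (\<omega> v)) :: nat) = of_bool (fst (snd v)) + of_bool (snd (snd v))"
    unfolding xyi snd_conv .
qed

lemma emeasure_cylinder:
  "emeasure P {\<omega> \<in> space P. \<forall>x<M. \<forall>y<N. \<omega> ((Suc x, Suc y), in_edges f x y) = out_edges f x y} =
   (\<Prod>y<N. \<Prod>x<M. ennreal (sixv_weight Q (\<xi> (Suc x) * u (Suc y)) (in_edges f x y) (out_edges f x y)))"
proof -
  define M' where "M' v = measure_pmf (sixv_pmf Q (\<xi> (fst (fst v)) * u (snd (fst v))) (snd v))"
    for v :: "(nat \<times> nat) \<times> (bool \<times> bool)"
  have P_eq: "P = PiM sixv_index M'"
    unfolding sixv_measure_def by (rule arg_cong[where f = "PiM sixv_index"]) (auto simp: M'_def)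
  interpret product_prob_space M' sixv_index
    by (rule product_prob_spaceI) (simp add: M'_def prob_space_measure_pmf)
  \<comment> \<open>One coordinate for each vertex of the rectangle; distinct vertices give distinct
    coordinates, so the probability factorises.\<close>
  define key where "key = (\<lambda>(y, x). ((Suc x, Suc y), in_edges f x y))"
  define X where "X v = {out_edges f (fst (fst v) - 1) (snd (fst v) - 1)}"
    for v :: "(nat \<times> nat) \<times> (bool \<times> bool)"
  let ?J = "key ` ({..<N} \<times> {..<M})"
  have inj: "inj_on key ({..<N} \<times> {..<M})" by (auto simp: inj_on_def key_def)
  have "(\<forall>x<M. \<forall>y<N. \<omega> ((Suc x, Suc y), in_edges f x y) = out_edges f x y) \<longleftrightarrow> (\<forall>v\<in>?J. \<omega> v \<in> X v)" for \<omega>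
    by (auto simp: key_def X_def)
  hence "emeasure P {\<omega> \<in> space P. \<forall>x<M. \<forall>y<N. \<omega> ((Suc x, Suc y), in_edges f x y) = out_edges f x y} =
      emeasure (PiM sixv_index M') {\<omega> \<in> space (PiM sixv_index M'). \<forall>v\<in>?J. \<omega> v \<in> X v}"
    by (simp only: P_eq)
  also have "\<dots> = (\<Prod>v\<in>?J. emeasure (M' v) (X v))"
    by (rule emeasure_PiM_Collect) (auto simp: sixv_index_def key_def M'_def)
  also have "\<dots> = (\<Prod>v\<in>{..<N} \<times> {..<M}. emeasure (M' (key v)) (X (key v)))"
    unfolding prod.reindex[OF inj] o_def ..
  also have "\<dots> = (\<Prod>y<N. \<Prod>x<M. emeasure (M' (key (y, x))) (X (key (y, x))))"
    by (simp add: prod.cartesian_product)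
  also have "\<dots> = (\<Prod>y<N. \<Prod>x<M. ennreal (sixv_weight Q (\<xi> (Suc x) * u (Suc y)) (in_edges f x y) (out_edges f x y)))"
    by (simp add: M'_def X_def key_def emeasure_pmf_single pmf_sixv_pmf[OF Q xu])
  finally show ?thesis .
qed

lemma measurable_col_len [measurable]: "(\<lambda>\<omega>. col_len \<omega> x y) \<in> measurable P (count_space UNIV)"
  unfolding col_len_def
  by (rule measurable_compose[OF measurable_sixv_height, where g = "\<lambda>h. y - h"]) simp_all

text \<open>If some step of f is neither 0 nor 1, both sides are 0: conserving configurations never
  produce such a step, and its vertex weight vanishes.\<close>

lemma emeasure_col_len:
  assumes f0: "\<And>x. x \<le> M \<Longrightarrow> f x 0 = 0" "\<And>y. y \<le> N \<Longrightarrow> f 0 y = 0"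
    and p: "\<And>x y. 1 \<le> x \<Longrightarrow> 1 \<le> y \<Longrightarrow> a x * b y * (sqrt Q * (\<xi> x * u y)) = 1"
  shows "emeasure P {\<omega> \<in> space P. \<forall>x\<le>M. \<forall>y\<le>N. col_len \<omega> x y = f x y} =
   (\<Prod>y<N. \<Prod>x<M. ennreal (vertex_weight Q (a (Suc x) * b (Suc y)) (f x y) (f (Suc x) y) (f x (Suc y)) (f (Suc x) (Suc y))))"
    (is "emeasure P ?E = _")
proof (cases "\<forall>x<M. \<forall>y<N. steps_ok f x y")
  case True
  have "emeasure P ?E = emeasure P {\<omega> \<in> space P. \<forall>x<M. \<forall>y<N. \<omega> ((Suc x, Suc y), in_edges f x y) = out_edges f x y}"
  proof (rule emeasure_eq_AE)
    show "AE \<omega> in P. \<omega> \<in> ?E \<longleftrightarrow> \<omega> \<in> {\<omega> \<in> space P. \<forall>x<M. \<forall>y<N. \<omega> ((Suc x, Suc y), in_edges f x y) = out_edges f x y}"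
      using AE_conserving
    proof eventually_elim
      case (elim \<omega>)
      have "(\<forall>x\<le>M. \<forall>y\<le>N. col_len \<omega> x y = f x y) \<longleftrightarrow> (\<forall>x<M. \<forall>y<N. \<omega> ((Suc x, Suc y), in_edges f x y) = out_edges f x y)"
        by (rule col_len_eq_iff[OF elim]) (use f0 True in auto)
      thus ?case by simp
    qed
    show "?E \<in> sets P" by measurable
    have [measurable]: "(\<lambda>\<omega>. \<omega> ((Suc x, Suc y), i)) \<in> measurable P (count_space UNIV)" for x y i
      by (rule measurable_sixv_component) (auto simp: sixv_index_def)
    show "{\<omega> \<in> space P. \<forall>x<M. \<forall>y<N. \<omega> ((Suc x, Suc y), in_edges f x y) = out_edges f x y} \<in> sets P"
      by measurable
  qed
  also have "\<dots> = (\<Prod>y<N. \<Prod>x<M. ennreal (vertex_weight Q (a (Suc x) * b (Suc y)) (f x y) (f (Suc x) y) (f x (Suc y)) (f (Suc x) (Suc y))))"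
    unfolding emeasure_cylinder
  proof (intro prod.cong refl)
    fix x y assume "y \<in> {..<N}" "x \<in> {..<M}"
    hence "steps_ok f x y" using True by simp
    thus "ennreal (sixv_weight Q (\<xi> (Suc x) * u (Suc y)) (in_edges f x y) (out_edges f x y)) =
      ennreal (vertex_weight Q (a (Suc x) * b (Suc y)) (f x y) (f (Suc x) y) (f x (Suc y)) (f (Suc x) (Suc y)))"
      unfolding in_edges_def out_edges_def steps_ok_def
      by (subst sixv_weight_eq_vertex_weight[OF Q xu p]) auto
  qed
  finally show ?thesis .
next
  case False
  then obtain x y where xy: "x < M" "y < N" "\<not> steps_ok f x y" by auto
  have "AE \<omega> in P. \<omega> \<notin> ?E"
    using AE_conserving
  proof eventually_elim
    case (elim \<omega>)
    show ?case
    proof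
      assume "\<omega> \<in> ?E"
      hence "steps_ok f x y = steps_ok (col_len \<omega>) x y" using xy by (simp add: steps_ok_def)
      thus False using steps_ok_col_len[OF elim] xy by simp
    qed
  qed
  hence zero: "emeasure P ?E = 0" by (subst emeasure_eq_0_AE) auto
  have inner: "(\<Prod>x<M. ennreal (vertex_weight Q (a (Suc x) * b (Suc y)) (f x y) (f (Suc x) y) (f x (Suc y)) (f (Suc x) (Suc y)))) = 0"
    using xy vertex_weight_eq_0[OF xy(3)] by (intro prod_zero bexI[of _ x]) auto
  have "(\<Prod>y<N. \<Prod>x<M. ennreal (vertex_weight Q (a (Suc x) * b (Suc y)) (f x y) (f (Suc x) y) (f x (Suc y)) (f (Suc x) (Suc y)))) = 0"
    by (rule prod_zero[OF finite_lessThan], rule bexI[of _ y]) (use inner xy in simp_all)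
  show ?thesis unfolding zero by (rule sym) fact
qed

end

section \<open>Histories of rows\<close>

definition col_len_row :: "((nat \<times> nat) \<times> (bool \<times> bool) \<Rightarrow> bool \<times> bool) \<Rightarrow> nat \<Rightarrow> nat \<Rightarrow> nat list" where
  "col_len_row \<omega> M y = map (\<lambda>x. col_len \<omega> (Suc x) y) [0..<M]"

primrec history :: "((nat \<times> nat) \<times> (bool \<times> bool) \<Rightarrow> bool \<times> bool) \<Rightarrow> nat \<Rightarrow> nat \<Rightarrow> nat list list" where
  "history \<omega> M 0 = []"
| "history \<omega> M (Suc y) = col_len_row \<omega> M (Suc y) # history \<omega> M y"

lemma col_len_row_0: "col_len_row \<omega> M 0 = replicate M 0"
  by (simp add: col_len_row_def col_len_0 map_replicate_const)

lemma col_len_row_history: "col_len_row \<omega> M N = hd (history \<omega> M N @ [replicate M 0])"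
  by (cases N) (simp_all add: col_len_row_0)

lemma length_history: "length (history \<omega> M N) = N"
  by (induction N) auto

lemma length_in_history: "rs \<in> set (history \<omega> M N) \<Longrightarrow> length rs = M"
  by (induction N) (auto simp: col_len_row_def)

lemma history_nth: "i \<le> N \<Longrightarrow> (history \<omega> M N @ [replicate M 0]) ! i = col_len_row \<omega> M (N - i)"
  by (induction N arbitrary: i) (auto simp: nth_Cons' col_len_row_0)

text \<open>Turns a list with the newest row first into a function on the grid: row y is found at
  distance y from the end, and the prepended 0 is the column x = 0.\<close>

definition history_fun :: "nat \<Rightarrow> nat list list \<Rightarrow> nat \<Rightarrow> nat \<Rightarrow> nat" where
  "history_fun M Rs x y = (0 # (Rs @ [replicate M 0]) ! (length Rs - y)) ! x"

lemma history_eq_iff: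
  assumes "length Rs = N" "\<forall>rs\<in>set Rs. length rs = M"
  shows "history \<omega> M N = Rs \<longleftrightarrow> (\<forall>x\<le>M. \<forall>y\<le>N. col_len \<omega> x y = history_fun M Rs x y)"
proof -
  have "0 # col_len_row \<omega> M y = map (\<lambda>x. col_len \<omega> x y) [0..<Suc M]" for y
    by (simp add: col_len_row_def map_upt_Suc col_len_0_left del: upt_Suc)
  hence nth: "(0 # col_len_row \<omega> M y) ! x = col_len \<omega> x y" if "x \<le> M" for x y
    using that by (simp del: upt_Suc)
  show ?thesis
  proof
    assume "history \<omega> M N = Rs"
    thus "\<forall>x\<le>M. \<forall>y\<le>N. col_len \<omega> x y = history_fun M Rs x y"
      using history_nth[of _ N \<omega> M] assms(1) by (auto simp: history_fun_def nth)
  next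
    assume *: "\<forall>x\<le>M. \<forall>y\<le>N. col_len \<omega> x y = history_fun M Rs x y"
    show "history \<omega> M N = Rs"
    proof (rule nth_equalityI)
      fix i assume "i < length (history \<omega> M N)"
      hence i: "i < N" by (simp add: length_history)
      hence l: "length (Rs ! i) = M" using assms by simp
      have "history \<omega> M N ! i = col_len_row \<omega> M (N - i)"
        using history_nth[of i N \<omega> M] i by (simp add: nth_append length_history)
      also have "\<dots> = Rs ! i"
      proof (rule nth_equalityI)
        fix x assume "x < length (col_len_row \<omega> M (N - i))"
        hence x: "x < M" by (simp add: col_len_row_def)
        have "col_len_row \<omega> M (N - i) ! x = col_len \<omega> (Suc x) (N - i)" using x by (simp add: col_len_row_def)
        also have "\<dots> = history_fun M Rs (Suc x) (N - i)" using * x by simp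
        also have "\<dots> = Rs ! i ! x" using i assms(1) by (simp add: history_fun_def nth_append)
        finally show "col_len_row \<omega> M (N - i) ! x = Rs ! i ! x" .
      qed (simp add: l col_len_row_def)
      finally show "history \<omega> M N ! i = Rs ! i" .
    qed (simp add: length_history assms)
  qed
qed

lemma row_wt_eq_prod:
  "length ns = length rs \<Longrightarrow> row_wt w j k l rs ns = (\<Prod>i<length rs. w (j + i) ((l # ns) ! i) (ns ! i) ((k # rs) ! i) (rs ! i))"
  by (induction w j k l rs ns rule: row_wt.induct) (simp_all add: prod.lessThan_Suc_shift del: prod.lessThan_Suc)

lemma history_weight_eq_prod:
  assumes "\<forall>rs\<in>set Rs. length rs = M"
  shows "history_weight t a b M Rs = (\<Prod>y<length Rs. \<Prod>x<M. vertex_weight t (a (Suc x) * b (Suc y))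
     (history_fun M Rs x y) (history_fun M Rs (Suc x) y) (history_fun M Rs x (Suc y)) (history_fun M Rs (Suc x) (Suc y)))"
  using assms
proof (induction Rs)
  case (Cons rs Rs)
  let ?h = "hd (Rs @ [replicate M 0])"
  have h: "length ?h = M" "length rs = M" using Cons.prems by (cases Rs; simp)+
  have 1: "history_fun M (rs # Rs) x y = history_fun M Rs x y" if "y \<le> length Rs" for x y
    using that by (simp add: history_fun_def Suc_diff_le)
  have 2: "history_fun M (rs # Rs) x (Suc (length Rs)) = (0 # rs) ! x" for x
    by (simp add: history_fun_def)
  have 3: "history_fun M Rs x (length Rs) = (0 # ?h) ! x" for x
    by (cases Rs) (simp_all add: history_fun_def)
  show ?case using Cons h by (simp add: row_wt_eq_prod 1 2 3 mult.commute)
qed simp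

text \<open>Row 0 has length M, and two successive rows of different lengths have weight 0. So the
  oldest row of wrong length makes the product vanish.\<close>

lemma history_weight_eq_0: "\<exists>rs\<in>set Rs. length rs \<noteq> M \<Longrightarrow> history_weight t a b M Rs = 0"
proof (induction Rs)
  case (Cons rs Rs)
  show ?case
  proof (cases "\<exists>rs\<in>set Rs. length rs \<noteq> M")
    case False
    hence "length (hd (Rs @ [replicate M 0])) = M" "length rs \<noteq> M" using Cons.prems by (cases Rs; auto)+
    thus ?thesis by (simp add: row_length)
  qed (use Cons.IH in simp)
qed simp

context sixv_params begin

lemma emeasure_history:
  assumes p: "\<And>x y. 1 \<le> x \<Longrightarrow> 1 \<le> y \<Longrightarrow> a x * b y * (sqrt Q * (\<xi> x * u y)) = 1"
    and p01: "\<And>x y. 1 \<le> x \<Longrightarrow> 1 \<le> y \<Longrightarrow> 0 \<le> a x * b y \<and> a x * b y < 1"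
    and N: "length Rs = N"
  shows "emeasure P {\<omega> \<in> space P. history \<omega> M N = Rs} = ennreal (history_weight Q a b M Rs)"
proof (cases "\<forall>rs\<in>set Rs. length rs = M")
  case True
  have 0: "history_fun M Rs x 0 = 0" if "x \<le> M" for x
    using that by (cases x) (simp_all add: history_fun_def)
  have 1: "history_fun M Rs 0 y = 0" for y by (simp add: history_fun_def)
  have nn: "0 \<le> vertex_weight Q (a (Suc x) * b (Suc y)) l n k r" for x y l n k r
    using Q p01[of "Suc x" "Suc y"] by (intro vertex_weight_nonneg) auto
  show ?thesis unfolding history_eq_iff[OF N True]
    by (subst emeasure_col_len[where a = a and b = b]) (auto simp: 0 1 p history_weight_eq_prod[OF True] N prod_ennreal nn prod_nonneg)
next
  case False
  hence "{\<omega> \<in> space P. history \<omega> M N = Rs} = {}" using length_in_history by auto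
  thus ?thesis using False history_weight_eq_0[of Rs M] by (simp only:) simp
qed

lemma measurable_history: "(\<lambda>\<omega>. history \<omega> M N) \<in> measurable P (count_space UNIV)"
proof (rule measurable_count_space_eq2_countable[THEN iffD2], intro conjI ballI)
  fix Rs
  show "(\<lambda>\<omega>. history \<omega> M N) -` {Rs} \<inter> space P \<in> sets P"
  proof (cases "length Rs = N \<and> (\<forall>rs\<in>set Rs. length rs = M)")
    case True
    hence "(\<lambda>\<omega>. history \<omega> M N) -` {Rs} \<inter> space P = {\<omega> \<in> space P. \<forall>x\<le>M. \<forall>y\<le>N. col_len \<omega> x y = history_fun M Rs x y}"
      using history_eq_iff[of Rs N M] by auto
    also have "\<dots> \<in> sets P" by measurable
    finally show ?thesis .
  next
    case False
    hence "(\<lambda>\<omega>. history \<omega> M N) -` {Rs} \<inter> space P = {}"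
      by (blast intro: length_history length_in_history)
    thus ?thesis by (simp only: sets.empty_sets)
  qed
qed simp

text \<open>Row N is determined by the history, so its law sums over the histories that end in it.
  This is the expression found in \<open>emeasure_hl_process\<close>.\<close>

lemma emeasure_col_len_row:
  assumes p: "\<And>x y. 1 \<le> x \<Longrightarrow> 1 \<le> y \<Longrightarrow> a x * b y * (sqrt Q * (\<xi> x * u y)) = 1"
    and p01: "\<And>x y. 1 \<le> x \<Longrightarrow> 1 \<le> y \<Longrightarrow> 0 \<le> a x * b y \<and> a x * b y < 1"
  shows "emeasure P {\<omega> \<in> space P. col_len_row \<omega> M N = rs} = (\<integral>\<^sup>+Rs. ennreal (history_weight Q a b M Rs) \<partial>count_space (histories M N rs))"
proof -
  let ?D = "distr P (count_space UNIV) (\<lambda>\<omega>. history \<omega> M N)"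
  have "emeasure P {\<omega> \<in> space P. col_len_row \<omega> M N = rs} = emeasure ?D (histories M N rs)"
    by (subst emeasure_distr[OF measurable_history])
       (auto simp: col_len_row_history length_history intro!: arg_cong[where f = "emeasure P"])
  also have "\<dots> = (\<integral>\<^sup>+Rs. emeasure ?D {Rs} \<partial>count_space (histories M N rs))"
    by (rule emeasure_countable_singleton) auto
  also have "\<dots> = (\<integral>\<^sup>+Rs. ennreal (history_weight Q a b M Rs) \<partial>count_space (histories M N rs))"
  proof (intro nn_integral_cong)
    fix Rs assume "Rs \<in> space (count_space (histories M N rs))"
    hence "length Rs = N" by simp
    have "emeasure ?D {Rs} = emeasure P {\<omega> \<in> space P. history \<omega> M N = Rs}"
      by (subst emeasure_distr[OF measurable_history]) (auto intro!: arg_cong[where f = "emeasure P"])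
    thus "emeasure ?D {Rs} = ennreal (history_weight Q a b M Rs)" using emeasure_history[OF p p01 \<open>length Rs = N\<close>] by simp
  qed
  finally show ?thesis .
qed

end

section \<open>Equality of the laws\<close>

theorem theorem4p1:
  fixes t Q :: real and a b \<xi> u :: "nat \<Rightarrow> real"
    and M N k :: nat and m :: "nat \<Rightarrow> nat"
  assumes "0 < t" "t < 1"
    and "\<forall>i\<ge>1. 0 < a i" and "\<forall>j\<ge>1. 0 < b j"
    and "\<forall>i\<ge>1. \<forall>j\<ge>1. a i * b j < 1"
    and "0 < Q" "Q < 1"
    and "\<forall>x\<ge>1. 0 < \<xi> x" and "\<forall>y\<ge>1. 0 < u y"
    and "\<forall>x\<ge>1. \<forall>y\<ge>1. \<xi> x * u y > 1 / sqrt Q"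
    and "t = Q"
    and "\<forall>x\<ge>1. a x = sqrt t / \<xi> x"
    and "\<forall>y\<ge>1. b y = 1 / (t * u y)"
    and "1 \<le> N" and "1 \<le> k"
    and "\<forall>i\<in>{1..k}. 1 \<le> m i" and "\<forall>i\<in>{1..k}. m i \<le> M"
  shows "distr (hl_process t a b M N) (count_space UNIV)
           (\<lambda>\<Lambda>. map (\<lambda>i. int N - int (length (hl_nth \<Lambda> (m i)))) [1..<k+1])
       = distr (sixv_measure Q \<xi> u) (count_space UNIV)
           (\<lambda>\<omega>. map (\<lambda>i. int (sixv_height \<omega> (m i + 1) N)) [1..<k+1])"
proof -
  let ?H = "hl_process t a b M N" and ?S = "sixv_measure Q \<xi> u"
  have tQ: "t = Q" by fact
  interpret hl_process_params t a b
    using assms by unfold_locales auto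
  interpret sixv_params Q \<xi> u
    using assms by unfold_locales auto
  \<comment> \<open>This is where the parameter relations meet: a_x b_y is the reciprocal of sqrt Q
    * xi_x * u_y, the value of p that matches the six vertex probabilities.\<close>
  have p: "a x * b y * (sqrt Q * (\<xi> x * u y)) = 1" if "1 \<le> x" "1 \<le> y" for x y
  proof -
    have "0 < \<xi> x" "0 < u y" and eq: "a x = sqrt Q / \<xi> x" "b y = 1 / (Q * u y)"
      using assms(8,9,11,12,13) that by auto
    hence "a x * b y * (sqrt Q * (\<xi> x * u y)) = (sqrt Q * sqrt Q) / Q"
      unfolding eq by simp
    also have "\<dots> = 1" using \<open>0 < Q\<close> by simp
    finally show ?thesis .
  qed
  have p01: "0 \<le> a x * b y \<and> a x * b y < 1" if "1 \<le> x" "1 \<le> y" for x y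
    using a b ab that by simp
  have sets_H: "space ?H = partition_seqs M" "sets ?H = Pow (partition_seqs M)"
    by (simp_all add: hl_process_def space_point_measure sets_point_measure)
  have mH: "f \<in> measurable ?H (count_space UNIV)" for f :: "nat list list \<Rightarrow> 'x"
    by (auto simp: measurable_def sets_H)
  have mS: "(\<lambda>\<omega>. col_len_row \<omega> M N) \<in> measurable ?S (count_space UNIV)"
    using measurable_compose[OF measurable_history[of M N], of "\<lambda>Rs. hd (Rs @ [replicate M 0])"]
    by (simp add: col_len_row_history)
  let ?f = "\<lambda>rs. map (\<lambda>i. int N - int (rs ! (m i - 1))) [1..<k+1]"
  \<comment> \<open>The joint law of all M column lengths is compared; the vectors in question are
    images of it under \<open>?f\<close>, where the length of the partition with superscript m sits
    at position m - 1.\<close>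
  have law: "distr ?H (count_space UNIV) (map length) = distr ?S (count_space UNIV) (\<lambda>\<omega>. col_len_row \<omega> M N)"
  proof (rule measure_eqI_countable)
    fix rs :: "nat list"
    have H: "emeasure (distr ?H (count_space UNIV) (map length)) {rs} =
        emeasure ?H {\<Lambda> \<in> partition_seqs M. map length \<Lambda> = rs}"
      by (subst emeasure_distr[OF mH]) (auto simp: sets_H intro!: arg_cong[where f = "emeasure ?H"])
    have S: "emeasure (distr ?S (count_space UNIV) (\<lambda>\<omega>. col_len_row \<omega> M N)) {rs} =
        emeasure ?S {\<omega> \<in> space ?S. col_len_row \<omega> M N = rs}"
      by (subst emeasure_distr[OF mS]) (auto intro!: arg_cong[where f = "emeasure ?S"])
    show "emeasure (distr ?H (count_space UNIV) (map length)) {rs} =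
      emeasure (distr ?S (count_space UNIV) (\<lambda>\<omega>. col_len_row \<omega> M N)) {rs}"
    proof (cases "length rs = M")
      case True
      have "emeasure ?S {\<omega> \<in> space ?S. col_len_row \<omega> M N = rs} =
          (\<integral>\<^sup>+Rs. ennreal (history_weight Q a b M Rs) \<partial>count_space (histories M N rs))"
        by (rule emeasure_col_len_row) (use p p01 in auto)
      thus ?thesis unfolding H S emeasure_hl_process[OF True] by (simp only: tQ)
    next
      case False
      hence "{\<Lambda> \<in> partition_seqs M. map length \<Lambda> = rs} = {}"
        "{\<omega> \<in> space ?S. col_len_row \<omega> M N = rs} = {}"
        by (auto simp: partition_seqs_def col_len_row_def)
      thus ?thesis unfolding H S by (simp only: emeasure_empty)
    qed
  qed auto
  have "distr ?H (count_space UNIV) (\<lambda>\<Lambda>. map (\<lambda>i. int N - int (length (hl_nth \<Lambda> (m i)))) [1..<k+1])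
      = distr ?H (count_space UNIV) (?f \<circ> map length)"
  proof (rule distr_cong)
    fix \<Lambda> assume "\<Lambda> \<in> space ?H"
    hence col_len: "length \<Lambda> = M" by (simp add: sets_H partition_seqs_def)
    have "length (hl_nth \<Lambda> (m i)) = map length \<Lambda> ! (m i - 1)" if "i \<in> set [1..<k+1]" for i
    proof -
      have "i \<in> {1..k}" using that by auto
      hence "1 \<le> m i" "m i \<le> length \<Lambda>" using assms(16,17) col_len by blast+
      thus ?thesis by (simp add: hl_nth_def nth_Cons')
    qed
    thus "map (\<lambda>i. int N - int (length (hl_nth \<Lambda> (m i)))) [1..<k+1] = (?f \<circ> map length) \<Lambda>"
      by (simp del: upt_Suc)
  qed auto
  also have "\<dots> = distr (distr ?H (count_space UNIV) (map length)) (count_space UNIV) ?f"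
    by (subst distr_distr[OF _ mH]) auto
  also have "\<dots> = distr ?S (count_space UNIV) (?f \<circ> (\<lambda>\<omega>. col_len_row \<omega> M N))"
    unfolding law by (subst distr_distr[OF _ mS]) auto
  also have "\<dots> = distr ?S (count_space UNIV) (\<lambda>\<omega>. map (\<lambda>i. int (sixv_height \<omega> (m i + 1) N)) [1..<k+1])"
  proof (rule distr_cong)
    fix \<omega>
    have "int N - int (col_len_row \<omega> M N ! (m i - 1)) = int (sixv_height \<omega> (m i + 1) N)"
      if "i \<in> set [1..<k+1]" for i
    proof -
      have "i \<in> {1..k}" using that by auto
      hence "1 \<le> m i" "m i \<le> M" using assms(16,17) by blast+
      hence "m i - 1 < M" "Suc (m i - 1) = m i" by auto
      thus ?thesis using sixv_height_le[of \<omega> "Suc (m i)" N] by (simp add: col_len_row_def col_len_def of_nat_diff)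
    qed
    thus "(?f \<circ> (\<lambda>\<omega>. col_len_row \<omega> M N)) \<omega> = map (\<lambda>i. int (sixv_height \<omega> (m i + 1) N)) [1..<k+1]"
      by (auto intro!: map_cong simp del: upt_Suc)
  qed auto
  finally show ?thesis .
qed

end
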